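(* Let $D\subset\mathbb{R}^2$ be a simply connected bounded domain and let $\{(h,f)_\nabla: f\in H(D)\}$ be a Gaussian free field on $D$. Let $f_0\in H(D)$ be such that $\Delta f_0$ is a negative constant on $D$, and put $T=\|f_0\|_\nabla^2$. Let $\gamma:[0,T]\to\overline{D}$ be a continuous space-filling (i.e. surjective) curve, and for $t\in[0,T]$ let $\gamma_t=\gamma([0,t])$ and let $P_t$ be the orthogonal projection of $H(D)$ onto the subspace $H^\perp_{D\setminus\gamma_t}(D)$ of functions harmonic in $D\setminus\gamma_t$. Assume that $\gamma$ is parameterized so that $\|P_t(f_0)\|_\nabla^2=t$ for all $t\in[0,T]$. For $t\in[0,T]$ define $$W(t):=\mathbb{E}\big((h,f_0)_\nabla\,\big|\,\mathcal{F}^\perp_{D\setminus\gamma_t}\big).$$ Then $W(t)=(h,P_t(f_0))_\nabla$ almost surely for each $t$, and $W$ has the same law (in the smallest $\sigma$-algebra in which each $W(t)$ is measurable, i.e. the same finite-dimensional distributions) as a standard Brownian motion on $[0,T]$ started at $0$.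
   Context: For a domain $D\subset\mathbb{R}^d$, $H_s(D)$ is the space of smooth real-valued functions on $\mathbb{R}^d$ supported on a compact subset of $D$, with Dirichlet inner product $(f_1,f_2)_\nabla=\int_D \nabla f_1\cdot\nabla f_2\,dx$ and $\|f\|_\nabla=(f,f)_\nabla^{1/2}$. $H(D)$ is the Hilbert space completion of $H_s(D)$ under this inner product. A Gaussian free field on $D$ is a Gaussian Hilbert space (a closed subspace of a real $L^2$ space of a probability space, consisting of centered Gaussian variables) of random variables denoted $(h,f)_\nabla$, one for each $f\in H(D)$, such that $f\mapsto (h,f)_\nabla$ is linear and $\mathbb{E}[(h,a)_\nabla(h,b)_\nabla]=(a,b)_\nabla$ for all $a,b\in H(D)$. For an open subset $U\subset D$, $H^\perp_U(D)$ is the closed subspace of $H(D)$ consisting of those functions in $H(D)$ that are harmonic on $U$, and $\mathcal{F}^\perp_U$ is the smallest $\sigma$-algebra in which $(h,f)_\nabla$ is measurable for every $f\in H^\perp_U(D)$. *)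

theory Defs
  imports "HOL-Probability.Probability"
begin

section \<open>Smooth functions and the Laplacian\<close>

definition partial_deriv :: "'a::euclidean_space \<Rightarrow> ('a \<Rightarrow> real) \<Rightarrow> 'a \<Rightarrow> real" where
  "partial_deriv b f x = frechet_derivative f (at x) b"

(* f is of class C^k on the open set S *)
primrec Ck_on :: "nat \<Rightarrow> 'a::euclidean_space set \<Rightarrow> ('a \<Rightarrow> real) \<Rightarrow> bool" where
  "Ck_on 0 S f \<longleftrightarrow> continuous_on S f"
| "Ck_on (Suc k) S f \<longleftrightarrow>
     (\<forall>x\<in>S. f differentiable (at x)) \<and> (\<forall>b\<in>Basis. Ck_on k S (partial_deriv b f))"

definition laplacian :: "('a::euclidean_space \<Rightarrow> real) \<Rightarrow> 'a \<Rightarrow> real" where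
  "laplacian f x = (\<Sum>b\<in>Basis. partial_deriv b (partial_deriv b f) x)"


section \<open>The Dirichlet space\<close>

definition H_s :: "'a::euclidean_space set \<Rightarrow> ('a \<Rightarrow> real) set" where
  "H_s D = {f. (\<forall>k. Ck_on k UNIV f) \<and> (\<exists>K. compact K \<and> K \<subseteq> D \<and> (\<forall>x. x \<notin> K \<longrightarrow> f x = 0))}"

definition dirichlet_form :: "'a::euclidean_space set \<Rightarrow> ('a \<Rightarrow> real) \<Rightarrow> ('a \<Rightarrow> real) \<Rightarrow> real" where
  "dirichlet_form D f g = (LINT x:D|lborel. (\<Sum>b\<in>Basis. partial_deriv b f x * partial_deriv b g x))"

text \<open>
  For bounded \<open>D\<close> the Poincare inequality makes every Dirichlet-Cauchy sequence in \<open>H_s D\<close>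
  converge in \<open>L\<^sup>2\<close>, and two such sequences have the same \<open>L\<^sup>2\<close> limit iff they are equivalent in the
  completion. The completion is therefore realised as a set of square integrable functions,
  two functions representing the same element iff they agree almost everywhere; the inner product
  is extended from \<open>H_s D\<close> by continuity. For unbounded \<open>D\<close> this realisation need not be complete.
\<close>

definition dirichlet_approx ::
    "'a::euclidean_space set \<Rightarrow> (nat \<Rightarrow> 'a \<Rightarrow> real) \<Rightarrow> ('a \<Rightarrow> real) \<Rightarrow> bool" where
  "dirichlet_approx D \<phi> f \<longleftrightarrow>
     (\<forall>n. \<phi> n \<in> H_s D) \<and>
     (\<forall>e>0. \<exists>N. \<forall>m\<ge>N. \<forall>n\<ge>N.
        dirichlet_form D (\<lambda>x. \<phi> m x - \<phi> n x) (\<lambda>x. \<phi> m x - \<phi> n x) < e) \<and>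
     f \<in> borel_measurable lborel \<and> integrable lborel (\<lambda>x. (f x)\<^sup>2) \<and>
     (\<lambda>n. LINT x|lborel. (\<phi> n x - f x)\<^sup>2) \<longlonglongrightarrow> 0"

definition H :: "'a::euclidean_space set \<Rightarrow> ('a \<Rightarrow> real) set" where
  "H D = {f. \<exists>\<phi>. dirichlet_approx D \<phi> f}"

definition dirichlet_inner :: "'a::euclidean_space set \<Rightarrow> ('a \<Rightarrow> real) \<Rightarrow> ('a \<Rightarrow> real) \<Rightarrow> real" where
  "dirichlet_inner D f g =
     (THE c. \<forall>\<phi> \<psi>. dirichlet_approx D \<phi> f \<longrightarrow> dirichlet_approx D \<psi> g \<longrightarrow>
        (\<lambda>n. dirichlet_form D (\<phi> n) (\<psi> n)) \<longlonglongrightarrow> c)"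

definition dirichlet_norm :: "'a::euclidean_space set \<Rightarrow> ('a \<Rightarrow> real) \<Rightarrow> real" where
  "dirichlet_norm D f = sqrt (dirichlet_inner D f f)"

(* Elements of H D are almost-everywhere classes, so the equation holds for a C^2 version. *)
definition has_laplacian_on ::
    "'a::euclidean_space set \<Rightarrow> ('a \<Rightarrow> real) \<Rightarrow> ('a \<Rightarrow> real) \<Rightarrow> bool" where
  "has_laplacian_on U f g \<longleftrightarrow>
     (\<exists>u. Ck_on 2 U u \<and> (AE x in lborel. x \<in> U \<longrightarrow> f x = u x) \<and> (\<forall>x\<in>U. laplacian u x = g x))"

definition H_perp :: "'a::euclidean_space set \<Rightarrow> 'a set \<Rightarrow> ('a \<Rightarrow> real) set" where
  "H_perp D U = {f \<in> H D. has_laplacian_on U f (\<lambda>_. 0)}"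

definition is_orth_proj ::
    "'a::euclidean_space set \<Rightarrow> ('a \<Rightarrow> real) set \<Rightarrow> (('a \<Rightarrow> real) \<Rightarrow> 'a \<Rightarrow> real) \<Rightarrow> bool" where
  "is_orth_proj D V P \<longleftrightarrow>
     (\<forall>f\<in>H D. P f \<in> V \<and> (\<forall>v\<in>V. dirichlet_inner D (\<lambda>x. f x - P f x) v = 0))"


section \<open>The Gaussian free field\<close>

(* The constant 0 counts as a (degenerate) centered Gaussian variable. *)
definition centered_gaussian :: "'w measure \<Rightarrow> ('w \<Rightarrow> real) \<Rightarrow> bool" where
  "centered_gaussian M X \<longleftrightarrow>
     X \<in> borel_measurable M \<and>
     ((AE \<omega> in M. X \<omega> = 0) \<or> (\<exists>\<sigma>>0. distributed M lborel X (normal_density 0 \<sigma>)))"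

(* A subspace of L^2 is given as the set of all versions of its elements. *)
definition gaussian_hilbert_space :: "'w measure \<Rightarrow> ('w \<Rightarrow> real) set \<Rightarrow> bool" where
  "gaussian_hilbert_space M G \<longleftrightarrow>
     prob_space M \<and>
     (\<forall>X\<in>G. centered_gaussian M X) \<and>
     (\<lambda>_. 0) \<in> G \<and>
     (\<forall>X\<in>G. \<forall>Y\<in>G. \<forall>a b. (\<lambda>\<omega>. a * X \<omega> + b * Y \<omega>) \<in> G) \<and>
     (\<forall>Y X. (\<forall>n::nat. Y n \<in> G) \<longrightarrow> X \<in> borel_measurable M \<longrightarrow> integrable M (\<lambda>\<omega>. (X \<omega>)\<^sup>2) \<longrightarrow>
        (\<lambda>n. LINT \<omega>|M. (Y n \<omega> - X \<omega>)\<^sup>2) \<longlonglongrightarrow> 0 \<longrightarrow> X \<in> G)"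

definition gaussian_free_field ::
    "'w measure \<Rightarrow> 'a::euclidean_space set \<Rightarrow> (('a \<Rightarrow> real) \<Rightarrow> 'w \<Rightarrow> real) \<Rightarrow> bool" where
  "gaussian_free_field M D h \<longleftrightarrow>
     gaussian_hilbert_space M {X \<in> borel_measurable M. \<exists>f\<in>H D. AE \<omega> in M. X \<omega> = h f \<omega>} \<and>
     (\<forall>f\<in>H D. h f \<in> borel_measurable M) \<and>
     (\<forall>f\<in>H D. \<forall>g\<in>H D. \<forall>a b.
        AE \<omega> in M. h (\<lambda>x. a * f x + b * g x) \<omega> = a * h f \<omega> + b * h g \<omega>) \<and>
     (\<forall>f\<in>H D. \<forall>g\<in>H D. (LINT \<omega>|M. h f \<omega> * h g \<omega>) = dirichlet_inner D f g)"

(* Only the sigma-algebra of this measure is relevant. *)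
definition F_perp ::
    "'w measure \<Rightarrow> 'a::euclidean_space set \<Rightarrow> (('a \<Rightarrow> real) \<Rightarrow> 'w \<Rightarrow> real) \<Rightarrow> 'a set \<Rightarrow> 'w measure" where
  "F_perp M D h U =
     sigma (space M) {h f -` B \<inter> space M | f B. f \<in> H_perp D U \<and> B \<in> sets borel}"


section \<open>Brownian motion\<close>

(* The finite-dimensional distributions of standard Brownian motion on [0,T]. *)
definition brownian_fdd :: "'w measure \<Rightarrow> real \<Rightarrow> (real \<Rightarrow> 'w \<Rightarrow> real) \<Rightarrow> bool" where
  "brownian_fdd M T B \<longleftrightarrow>
     prob_space M \<and>
     (\<forall>t\<in>{0..T}. B t \<in> borel_measurable M) \<and>
     (AE \<omega> in M. B 0 \<omega> = 0) \<and>
     (\<forall>s t. 0 \<le> s \<longrightarrow> s < t \<longrightarrow> t \<le> T \<longrightarrow>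
        distributed M lborel (\<lambda>\<omega>. B t \<omega> - B s \<omega>) (normal_density 0 (sqrt (t - s)))) \<and>
     (\<forall>(n::nat) \<tau>. (\<forall>i\<le>n. \<tau> i \<in> {0..T}) \<longrightarrow> (\<forall>i<n. \<tau> i \<le> \<tau> (Suc i)) \<longrightarrow>
        prob_space.indep_vars M (\<lambda>_. borel) (\<lambda>i \<omega>. B (\<tau> (Suc i)) \<omega> - B (\<tau> i) \<omega>) {..<n})"

definition standard_brownian_motion :: "'w measure \<Rightarrow> real \<Rightarrow> (real \<Rightarrow> 'w \<Rightarrow> real) \<Rightarrow> bool" where
  "standard_brownian_motion M T B \<longleftrightarrow>
     brownian_fdd M T B \<and> (AE \<omega> in M. continuous_on {0..T} (\<lambda>t. B t \<omega>))"

definition process_law :: "'w measure \<Rightarrow> real \<Rightarrow> (real \<Rightarrow> 'w \<Rightarrow> real) \<Rightarrow> (real \<Rightarrow> real) measure" where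
  "process_law M T X = distr M (Pi\<^sub>M {0..T} (\<lambda>_. borel)) (\<lambda>\<omega>. \<lambda>t\<in>{0..T}. X t \<omega>)"

end

theory Submission
  imports Defs
begin

text \<open>
  The residual \<open>f0 - P t f0\<close> is orthogonal to \<open>H_perp D (D - \<gamma> ` {0..t})\<close>, and for jointly Gaussian
  variables orthogonality is independence; hence \<open>W t = h (P t f0)\<close>. The subspaces
  \<open>H_perp D (D - \<gamma> ` {0..t})\<close> increase with \<open>t\<close>, so for \<open>s \<le> t\<close> the covariance of \<open>W s\<close> and \<open>W t\<close> is
  \<open>(dirichlet_norm D (P s f0))\<^sup>2 = s\<close>. A centered Gaussian process is determined by its covariance,
  and this is that of Brownian motion.

  Both independence claims come from one uniqueness theorem: finite measures under which all elements
  of a linear space of random variables have the same characteristic function at \<open>1\<close> agree on the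
  \<open>\<sigma>\<close>-algebra which that space generates.
\<close>

section \<open>The Dirichlet space\<close>

text \<open>\<open>h\<close> is linear only up to null sets, and \<open>dirichlet_inner\<close> is a
  definite description whose bilinearity would need a proof of its own. The Hilbert space
  computations are therefore carried out among random variables: the covariance identity of the
  field turns an inner product into an expectation, where bilinearity is that of the integral. The
  Dirichlet side contributes that \<open>H D\<close> is closed under differences, so that
  \<open>h\<close> may be applied to a residual, and that harmonicity passes to smaller sets. On the
  probabilistic side the obstacle is that \<open>F_perp\<close> is generated by infinitely many
  variables, while Levy's uniqueness theorem concerns one real variable. It is made to suffice by
  adding one constraint X \<in> B at a time and carrying along the integrals of all exp(iv) over the
  cylinder built so far. Independence of the residual X is needed only as the vanishing of its
  integral over every event of \<open>F_perp\<close>. Since X is a signed weight, it is replaced by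
  the positive density 1 + sin(sX), to which a uniqueness theorem for measures applies.\<close>

lemma partial_deriv_diff:
  assumes "f differentiable (at x)" "g differentiable (at x)"
  shows "partial_deriv b (\<lambda>x. f x - g x) x = partial_deriv b f x - partial_deriv b g x"
proof -
  have "((\<lambda>x. f x - g x) has_derivative
      (\<lambda>y. frechet_derivative f (at x) y - frechet_derivative g (at x) y)) (at x)"
    using assms by (intro has_derivative_diff) (simp_all add: frechet_derivative_works[symmetric])
  from frechet_derivative_at[OF this] show ?thesis
    by (simp add: partial_deriv_def) metis
qed

lemma Ck_on_diff:
  "Ck_on k UNIV f \<Longrightarrow> Ck_on k UNIV g \<Longrightarrow> Ck_on k UNIV (\<lambda>x. f x - g x)"
proof (induction k arbitrary: f g)
  case (Suc k)
  have "partial_deriv b (\<lambda>x. f x - g x) = (\<lambda>x. partial_deriv b f x - partial_deriv b g x)" for b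
    using Suc.prems by (simp add: partial_deriv_diff fun_eq_iff)
  with Suc show ?case by (auto intro: differentiable_diff)
qed (auto intro: continuous_on_diff)

lemma Ck_on_mono: "Ck_on k S f \<Longrightarrow> T \<subseteq> S \<Longrightarrow> Ck_on k T f"
  by (induction k arbitrary: f) (auto intro: continuous_on_subset)

text \<open>The C^2 version that witnesses harmonicity on \<open>U'\<close> also serves on
  \<open>U\<close>. The traced set grows with t and its complement shrinks, so this is what makes
  the projections nested.\<close>

lemma H_perp_antimono: "U \<subseteq> U' \<Longrightarrow> H_perp D U' \<subseteq> H_perp D U"
  unfolding H_perp_def has_laplacian_on_def
  by (fast intro: Ck_on_mono elim: AE_mp)

lemma H_s_diff:
  assumes "f \<in> H_s D" "g \<in> H_s D"
  shows "(\<lambda>x. f x - g x) \<in> H_s D"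
proof -
  obtain K L where "compact K" "K \<subseteq> D" "\<And>x. x \<notin> K \<Longrightarrow> f x = 0"
    and "compact L" "L \<subseteq> D" "\<And>x. x \<notin> L \<Longrightarrow> g x = 0"
    using assms unfolding H_s_def by blast
  then have "compact (K \<union> L)" "K \<union> L \<subseteq> D" "\<forall>x. x \<notin> K \<union> L \<longrightarrow> f x - g x = 0"
    by (auto intro: compact_Un)
  with assms show ?thesis
    unfolding H_s_def by (auto intro: Ck_on_diff)
qed

section \<open>Integrability of test functions and of their gradients\<close>

lemma H_s_differentiable: "f \<in> H_s D \<Longrightarrow> f differentiable (at x)"
  unfolding H_s_def by (auto dest!: spec[of _ "Suc 0"])

lemma H_s_continuous: "f \<in> H_s D \<Longrightarrow> continuous_on UNIV f"
  unfolding H_s_def by (auto dest!: spec[of _ 0])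

lemma H_s_continuous_partial_deriv:
  "f \<in> H_s D \<Longrightarrow> b \<in> Basis \<Longrightarrow> continuous_on UNIV (partial_deriv b f)"
  unfolding H_s_def by (auto dest!: spec[of _ "Suc 0"])

lemma integrable_continuous_compact_support:
  fixes f :: "'a::euclidean_space \<Rightarrow> real"
  assumes "continuous_on UNIV f" "compact K" "\<And>x. x \<notin> K \<Longrightarrow> f x = 0"
  shows "integrable lborel f"
proof -
  have "integrable lborel (\<lambda>x. indicator K x *\<^sub>R f x)"
    using assms by (intro borel_integrable_compact) (auto intro: continuous_on_subset)
  also have "(\<lambda>x. indicator K x *\<^sub>R f x) = f"
    using assms(3) by (auto simp: fun_eq_iff indicator_def)
  finally show ?thesis .
qed

lemma H_s_square_integrable:
  assumes "f \<in> H_s D"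
  shows "integrable lborel (\<lambda>x. (f x)\<^sup>2)"
proof -
  obtain K where "compact K" "\<And>x. x \<notin> K \<Longrightarrow> f x = 0"
    using assms unfolding H_s_def by blast
  then show ?thesis
    using assms
    by (intro integrable_continuous_compact_support[of _ K] continuous_on_power H_s_continuous) auto
qed

text \<open>A non-integrable function has Bochner integral 0, so comparing Dirichlet energies by
  monotonicity requires integrability of the energy densities first.\<close>

lemma H_s_dirichlet_integrable:
  fixes f :: "'a::euclidean_space \<Rightarrow> real"
  assumes "f \<in> H_s D"
  shows "integrable lborel (\<lambda>x. \<Sum>b\<in>Basis. partial_deriv b f x * partial_deriv b f x)"
proof -
  obtain K where K: "compact K" "\<And>x. x \<notin> K \<Longrightarrow> f x = 0"
    using assms unfolding H_s_def by blast
  \<comment> \<open>The derivative at x depends on values near x; since \<open>- K\<close> is open,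
    \<open>f\<close> vanishes on a whole neighbourhood.\<close>
  have "partial_deriv b f x = 0" if "x \<notin> K" for x b
  proof -
    have "open (- K)" using K by (simp add: compact_imp_closed open_Compl)
    then have "frechet_derivative f (at x) = frechet_derivative (\<lambda>_. 0) (at x)"
      using that K by (intro frechet_derivative_transform_within_open[of _ _ "- K"] H_s_differentiable[OF assms]) auto
    then show ?thesis by (simp add: partial_deriv_def)
  qed
  then show ?thesis
    using assms K by (intro integrable_continuous_compact_support[of _ K])
      (auto intro!: continuous_intros H_s_continuous_partial_deriv)
qed

text \<open>Replaces the triangle inequality: it costs a factor 2 but stays with squared norms, the
  form in which \<open>dirichlet_approx\<close> expresses both of its limits.\<close>

lemma diff_square_le: "(a - b)\<^sup>2 \<le> 2 * a\<^sup>2 + 2 * (b::real)\<^sup>2"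
  using zero_le_power2[of "a + b"] unfolding power2_sum power2_diff by simp

lemma dirichlet_form_diff_le:
  assumes "open D" "f \<in> H_s D" "g \<in> H_s D"
  shows "dirichlet_form D (\<lambda>x. f x - g x) (\<lambda>x. f x - g x) \<le> 2 * dirichlet_form D f f + 2 * dirichlet_form D g g"
proof -
  let ?e = "\<lambda>f x. \<Sum>b\<in>Basis. partial_deriv b f x * partial_deriv b f x"
  have [measurable]: "D \<in> sets lborel" using assms by simp
  have int: "set_integrable lborel D (?e f)" if "f \<in> H_s D" for f
    unfolding set_integrable_def using assms(1)
    by (intro integrable_mult_indicator H_s_dirichlet_integrable[OF that]) auto
  have "?e (\<lambda>x. f x - g x) x \<le> 2 * ?e f x + 2 * ?e g x" for x
    unfolding sum_distrib_left sum.distrib[symmetric]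
    using diff_square_le by (intro sum_mono)
      (simp add: partial_deriv_diff H_s_differentiable[OF assms(2)] H_s_differentiable[OF assms(3)]
        power2_eq_square)
  then have "dirichlet_form D (\<lambda>x. f x - g x) (\<lambda>x. f x - g x) \<le> (LINT x:D|lborel. 2 * ?e f x + 2 * ?e g x)"
    unfolding dirichlet_form_def
    by (intro set_integral_mono set_integral_add set_integrable_mult_right int H_s_diff assms)
  also have "\<dots> = 2 * dirichlet_form D f f + 2 * dirichlet_form D g g"
    unfolding dirichlet_form_def using assms int
    by (simp add: set_integral_add set_integrable_mult_right)
  finally show ?thesis .
qed

lemma square_integrable_diff:
  fixes f g :: "'a \<Rightarrow> real"
  assumes [measurable]: "f \<in> borel_measurable M" "g \<in> borel_measurable M"
    and "integrable M (\<lambda>x. (f x)\<^sup>2)" "integrable M (\<lambda>x. (g x)\<^sup>2)"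
  shows "integrable M (\<lambda>x. (f x - g x)\<^sup>2)"
  using assms(3,4)
  by (intro Bochner_Integration.integrable_bound[of M "\<lambda>x. 2 * (f x)\<^sup>2 + 2 * (g x)\<^sup>2" "\<lambda>x. (f x - g x)\<^sup>2"])
     (auto intro!: AE_I2 order.trans[OF diff_square_le])

text \<open>The approximating sequences are subtracted termwise. The linearity and the covariance of
  the field speak only of elements of \<open>H D\<close>, so a residual f - p must be known to lie
  there.\<close>

lemma H_diff:
  fixes D :: "'a::euclidean_space set"
  assumes "open D" "f \<in> H D" "g \<in> H D"
  shows "(\<lambda>x. f x - g x) \<in> H D"
proof -
  from assms obtain \<phi> \<psi> where \<phi>: "dirichlet_approx D \<phi> f" and \<psi>: "dirichlet_approx D \<psi> g"
    unfolding H_def by blast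
  have s: "\<phi> n \<in> H_s D" "\<psi> n \<in> H_s D" for n
    using \<phi> \<psi> by (auto simp: dirichlet_approx_def)
  have [measurable]: "f \<in> borel_measurable lborel" "g \<in> borel_measurable lborel"
    and sq: "integrable lborel (\<lambda>x. (f x)\<^sup>2)" "integrable lborel (\<lambda>x. (g x)\<^sup>2)"
    using \<phi> \<psi> by (auto simp: dirichlet_approx_def)
  have [measurable]: "\<phi> n \<in> borel_measurable lborel" "\<psi> n \<in> borel_measurable lborel" for n
    using H_s_continuous[OF s(1)] H_s_continuous[OF s(2)]
    by (auto intro: borel_measurable_continuous_onI)
  have "dirichlet_approx D (\<lambda>n x. \<phi> n x - \<psi> n x) (\<lambda>x. f x - g x)"
    unfolding dirichlet_approx_def
  proof (intro conjI allI impI)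
    show "(\<lambda>x. \<phi> n x - \<psi> n x) \<in> H_s D" for n
      by (intro H_s_diff s)
    fix e :: real assume "e > 0"
    \<comment> \<open>\<open>dirichlet_form_diff_le\<close> doubles each of the two energies: 2(e/4)
      + 2(e/4) = e.\<close>
    then have "e / 4 > 0" by simp
    then obtain N1 N2 where
      N1: "\<And>m n. m \<ge> N1 \<Longrightarrow> n \<ge> N1 \<Longrightarrow>
        dirichlet_form D (\<lambda>x. \<phi> m x - \<phi> n x) (\<lambda>x. \<phi> m x - \<phi> n x) < e / 4" and
      N2: "\<And>m n. m \<ge> N2 \<Longrightarrow> n \<ge> N2 \<Longrightarrow>
        dirichlet_form D (\<lambda>x. \<psi> m x - \<psi> n x) (\<lambda>x. \<psi> m x - \<psi> n x) < e / 4"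
      using \<phi> \<psi> unfolding dirichlet_approx_def by meson
    show "\<exists>N. \<forall>m\<ge>N. \<forall>n\<ge>N. dirichlet_form D (\<lambda>x. (\<phi> m x - \<psi> m x) - (\<phi> n x - \<psi> n x))
        (\<lambda>x. (\<phi> m x - \<psi> m x) - (\<phi> n x - \<psi> n x)) < e"
    proof (intro exI allI impI)
      fix m n assume mn: "m \<ge> max N1 N2" "n \<ge> max N1 N2"
      have eq: "(\<phi> m x - \<psi> m x) - (\<phi> n x - \<psi> n x) = (\<phi> m x - \<phi> n x) - (\<psi> m x - \<psi> n x)" for x
        by simp
      show "dirichlet_form D (\<lambda>x. (\<phi> m x - \<psi> m x) - (\<phi> n x - \<psi> n x))
        (\<lambda>x. (\<phi> m x - \<psi> m x) - (\<phi> n x - \<psi> n x)) < e"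
        unfolding eq
        using dirichlet_form_diff_le[OF assms(1) H_s_diff[OF s(1)[of m] s(1)[of n]]
            H_s_diff[OF s(2)[of m] s(2)[of n]]] N1[of m n] N2[of m n] mn
        by simp
    qed
  next
    show "integrable lborel (\<lambda>x. (f x - g x)\<^sup>2)"
      by (intro square_integrable_diff sq) auto
    have int: "integrable lborel (\<lambda>x. (\<phi> n x - f x)\<^sup>2)" "integrable lborel (\<lambda>x. (\<psi> n x - g x)\<^sup>2)" for n
      by (intro square_integrable_diff sq H_s_square_integrable[OF s(1)]
          H_s_square_integrable[OF s(2)]; measurable)+
    have "(LINT x|lborel. (\<phi> n x - \<psi> n x - (f x - g x))\<^sup>2)
        \<le> (LINT x|lborel. 2 * (\<phi> n x - f x)\<^sup>2 + 2 * (\<psi> n x - g x)\<^sup>2)" for n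
    proof (rule integral_mono')
      show "integrable lborel (\<lambda>x. 2 * (\<phi> n x - f x)\<^sup>2 + 2 * (\<psi> n x - g x)\<^sup>2)"
        using int by simp
      show "(\<phi> n x - \<psi> n x - (f x - g x))\<^sup>2 \<le> 2 * (\<phi> n x - f x)\<^sup>2 + 2 * (\<psi> n x - g x)\<^sup>2" for x
        using diff_square_le[of "\<phi> n x - f x" "\<psi> n x - g x"] by (simp add: algebra_simps)
    qed simp
    also have "\<And>n. (LINT x|lborel. 2 * (\<phi> n x - f x)\<^sup>2 + 2 * (\<psi> n x - g x)\<^sup>2)
        = 2 * (LINT x|lborel. (\<phi> n x - f x)\<^sup>2) + 2 * (LINT x|lborel. (\<psi> n x - g x)\<^sup>2)"
      using int by simp
    finally have le: "(LINT x|lborel. (\<phi> n x - \<psi> n x - (f x - g x))\<^sup>2)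
        \<le> 2 * (LINT x|lborel. (\<phi> n x - f x)\<^sup>2) + 2 * (LINT x|lborel. (\<psi> n x - g x)\<^sup>2)" for n .
    have "(\<lambda>n. LINT x|lborel. (\<phi> n x - f x)\<^sup>2) \<longlonglongrightarrow> 0" "(\<lambda>n. LINT x|lborel. (\<psi> n x - g x)\<^sup>2) \<longlonglongrightarrow> 0"
      using \<phi> \<psi> by (auto simp: dirichlet_approx_def)
    then have "(\<lambda>n. 2 * (LINT x|lborel. (\<phi> n x - f x)\<^sup>2) + 2 * (LINT x|lborel. (\<psi> n x - g x)\<^sup>2)) \<longlonglongrightarrow> 2 * 0 + 2 * 0"
      by (intro tendsto_intros)
    then have lim: "(\<lambda>n. 2 * (LINT x|lborel. (\<phi> n x - f x)\<^sup>2) + 2 * (LINT x|lborel. (\<psi> n x - g x)\<^sup>2)) \<longlonglongrightarrow> 0"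
      by (simp only: mult_zero_right add_0_right)
    show "(\<lambda>n. LINT x|lborel. (\<phi> n x - \<psi> n x - (f x - g x))\<^sup>2) \<longlonglongrightarrow> 0"
      by (rule tendsto_sandwich[OF _ _ tendsto_const lim])
        (intro always_eventually allI le Bochner_Integration.integral_nonneg zero_le_power2)+
  qed auto
  then show ?thesis unfolding H_def by blast
qed

section \<open>Uniqueness theorems for characteristic functions\<close>

text \<open>Normalising the weighted measure and pushing it forward along \<open>X\<close> gives a
  probability law on the line, whose characteristic function is the weighted integral divided by the
  total weight. Levy's theorem applies unless the total weight is 0, and then the weight vanishes
  almost everywhere.\<close>

lemma weighted_char_uniqueness:
  fixes X w :: "'a \<Rightarrow> real"
  assumes Q: "finite_measure Q1" "finite_measure Q2"
    and X: "X \<in> borel_measurable Q1" "X \<in> borel_measurable Q2"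
    and w: "w \<in> borel_measurable Q1" "w \<in> borel_measurable Q2" "\<And>x. 0 \<le> w x" "\<And>x. w x \<le> c"
    and eq: "\<And>t. (CLINT x|Q1. w x *\<^sub>R iexp (t * X x)) = (CLINT x|Q2. w x *\<^sub>R iexp (t * X x))"
    and B: "B \<in> sets borel"
  shows "(LINT x|Q1. w x * indicator B (X x)) = (LINT x|Q2. w x * indicator B (X x))"
proof -
  define N where "N Q = distr (density Q (\<lambda>x. ennreal (w x / (LINT x|Q. w x)))) borel X" for Q
  have N: "real_distribution (N Q)" (is ?real)
      "char (N Q) t = (CLINT x|Q. w x *\<^sub>R iexp (t * X x)) / (LINT x|Q. w x)" (is ?char)
      "(LINT x|Q. w x * indicator B (X x)) = (LINT x|Q. w x) * measure (N Q) B" (is ?measure)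
    if Q: "finite_measure Q" and [measurable]: "X \<in> borel_measurable Q" "w \<in> borel_measurable Q"
      and nz: "(LINT x|Q. w x) \<noteq> 0" for Q t
  proof -
    interpret finite_measure Q by fact
    define m where "m = (LINT x|Q. w x)"
    have m: "m > 0" using nz Bochner_Integration.integral_nonneg[of Q w] w(3) unfolding m_def by (auto simp: less_le)
    \<comment> \<open>A nonzero Bochner integral forces integrability, the integral of a
      non-integrable function being 0 by convention.\<close>
    have int: "integrable Q w"
      using nz not_integrable_integral_eq by blast
    have "emeasure (density Q (\<lambda>x. ennreal (w x / m))) (space Q) = (\<integral>\<^sup>+x. ennreal (w x / m) \<partial>Q)"
      by (subst emeasure_density) (auto intro!: nn_integral_cong)
    also have "\<dots> = ennreal (LINT x|Q. w x / m)"
      using int m w(3) by (intro nn_integral_eq_integral) auto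
    also have "\<dots> = 1"
      using m by (simp add: m_def[symmetric])
    finally interpret d: prob_space "density Q (\<lambda>x. ennreal (w x / m))"
      by (intro prob_spaceI) simp
    show ?real
      unfolding N_def m_def[symmetric] by (rule d.real_distribution_distr) simp
    have "char (N Q) t = (CLINT x|Q. (w x / m) *\<^sub>R iexp (t * X x))"
      unfolding N_def m_def[symmetric] char_def using m w(3)
      by (subst integral_distr) (auto simp: integral_density)
    also have "\<dots> = (CLINT x|Q. (w x *\<^sub>R iexp (t * X x)) / m)"
      by (simp add: scaleR_conv_of_real)
    finally show ?char unfolding m_def by simp
    have "measure (N Q) B = (LINT x|N Q. indicator B x)"
      using B by (simp add: N_def)
    also have "\<dots> = (LINT x|Q. (w x / m) *\<^sub>R indicator B (X x))"
      unfolding N_def m_def[symmetric] using m w(3) B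
      by (subst integral_distr) (auto simp: integral_density)
    also have "\<dots> = (LINT x|Q. w x * indicator B (X x)) / m"
      by simp
    finally show ?measure using m unfolding m_def by simp
  qed
  have zero: "(LINT x|Q. w x * indicator B (X x)) = 0"
    if Q: "finite_measure Q" and [measurable]: "X \<in> borel_measurable Q" "w \<in> borel_measurable Q"
      and z: "(LINT x|Q. w x) = 0" for Q
  proof -
    interpret finite_measure Q by fact
    \<comment> \<open>An integral equal to 0 could be that default value, so integrability comes
      from the bound \<open>c\<close>.\<close>
    have "integrable Q w"
      using w(3,4) by (intro integrable_const_bound[of _ c]) auto
    then have "AE x in Q. w x = 0"
      using z w(3) by (subst (asm) integral_nonneg_eq_0_iff_AE) auto
    then have "(LINT x|Q. w x * indicator B (X x)) = (LINT x|Q. 0)"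
      using B by (intro integral_cong_AE) auto
    then show ?thesis by simp
  qed
  \<comment> \<open>The characteristic functions at t = 0 give equal total weights.\<close>
  have "complex_of_real (LINT x|Q1. w x) = complex_of_real (LINT x|Q2. w x)"
    using eq[of 0] by (simp add: scaleR_conv_of_real)
  then have m: "(LINT x|Q1. w x) = (LINT x|Q2. w x)"
    by simp
  show ?thesis
  proof (cases "(LINT x|Q1. w x) = 0")
    case True
    then show ?thesis using zero[OF Q(1) X(1) w(1)] zero[OF Q(2) X(2) w(2)] m by simp
  next
    case False
    then have "N Q1 = N Q2"
      using m N(2)[OF Q(1) X(1) w(1)] N(2)[OF Q(2) X(2) w(2)] eq
      by (intro Levy_uniqueness N(1) Q X w ext) auto
    then show ?thesis
      using False m N(3)[OF Q(1) X(1) w(1)] N(3)[OF Q(2) X(2) w(2)] by simp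
  qed
qed

text \<open>Weighting with \<open>1 + Re (c * iexp v)\<close>, which is nonnegative for \<open>norm c \<le> 1\<close>, reduces the step
  from \<open>C\<close> to \<open>C \<inter> X -` B\<close> to the one-dimensional uniqueness theorem for positive measures.\<close>

lemma trig_integral_eq_Int_vimage:
  fixes X v :: "'a \<Rightarrow> real"
  assumes Q: "finite_measure Q1" "finite_measure Q2" "sets Q1 = sets M" "sets Q2 = sets M"
    and [measurable]: "X \<in> borel_measurable M" "v \<in> borel_measurable M" "C \<in> sets M" "B \<in> sets borel"
    and eq: "\<And>s t. (CLINT x|Q1. indicator C x *\<^sub>R iexp (s * X x + t * v x))
        = (CLINT x|Q2. indicator C x *\<^sub>R iexp (s * X x + t * v x))"
  shows "(CLINT x|Q1. indicator (C \<inter> (X -` B \<inter> space M)) x *\<^sub>R iexp (v x))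
      = (CLINT x|Q2. indicator (C \<inter> (X -` B \<inter> space M)) x *\<^sub>R iexp (v x))"
proof -
  note [measurable_cong] = Q(3,4)
  define w where "w c x = indicator C x * (1 + Re (c * iexp (v x)))" for c x
  let ?CB = "C \<inter> (X -` B \<inter> space M)"
  have bnd: "\<bar>Re (c * iexp (v x))\<bar> \<le> 1" if "norm c \<le> 1" for c x
    using abs_Re_le_cmod[of "c * iexp (v x)"] that by (simp add: norm_mult)
  have w: "0 \<le> w c x" "w c x \<le> 2" if "norm c \<le> 1" for c x
    using bnd[OF that, of x] by (auto simp: w_def indicator_def)
  \<comment> \<open>Writing Re z as half of z plus its conjugate expresses the weighted integral by
    the integrals of the hypothesis with coefficient 0, 1 and -1 in front of
    \<open>v\<close>.\<close>
  have split: "(CLINT x|Q. w c x *\<^sub>R iexp (t * X x))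
      = (CLINT x|Q. indicator C x *\<^sub>R iexp (t * X x + 0 * v x))
        + c / 2 * (CLINT x|Q. indicator C x *\<^sub>R iexp (t * X x + 1 * v x))
        + cnj c / 2 * (CLINT x|Q. indicator C x *\<^sub>R iexp (t * X x + (-1) * v x))"
    if "finite_measure Q" and [measurable_cong]: "sets Q = sets M" for Q c t
  proof -
    interpret finite_measure Q by fact
    have int: "integrable Q (\<lambda>x. indicator C x *\<^sub>R iexp (s * X x + t * v x))" for s t
      by (intro integrable_const_bound[of _ 1]) (auto simp: indicator_def)
    have "w c x *\<^sub>R iexp (t * X x) = indicator C x *\<^sub>R iexp (t * X x + 0 * v x)
        + c / 2 * (indicator C x *\<^sub>R iexp (t * X x + 1 * v x))
        + cnj c / 2 * (indicator C x *\<^sub>R iexp (t * X x + (-1) * v x))" for x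
    proof -
      have "cnj (iexp (v x)) = iexp (- v x)"
        by (simp add: exp_cnj)
      then have Re: "complex_of_real (Re (c * iexp (v x))) = (c * iexp (v x) + cnj c * iexp (- v x)) / 2"
        using complex_add_cnj[of "c * iexp (v x)"] by simp
      have "complex_of_real (w c x) = indicator C x * (1 + (c * iexp (v x) + cnj c * iexp (- v x)) / 2)"
        unfolding w_def of_real_mult of_real_add Re by (simp add: indicator_def)
      then show ?thesis
        by (simp add: scaleR_conv_of_real exp_add[symmetric] indicator_def algebra_simps add_divide_distrib)
    qed
    then show ?thesis
      by (simp only: Bochner_Integration.integral_add integral_mult_right_zero integrable_mult_right
          Bochner_Integration.integrable_add int)
  qed
  have wB: "(LINT x|Q1. w c x * indicator B (X x)) = (LINT x|Q2. w c x * indicator B (X x))"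
    if c: "norm c \<le> 1" for c
  proof (rule weighted_char_uniqueness[where c = 2, OF Q(1,2)])
    show "w c \<in> borel_measurable Q1" "w c \<in> borel_measurable Q2"
      unfolding w_def[abs_def] by measurable
    show "(CLINT x|Q1. w c x *\<^sub>R iexp (t * X x)) = (CLINT x|Q2. w c x *\<^sub>R iexp (t * X x))" for t
      by (simp only: split[OF Q(1,3)] split[OF Q(2,4)] eq)
  qed (auto simp: w[OF c])
  \<comment> \<open>The same weight, now integrated over X \<in> B, exhibits the desired integral
    through its product with an arbitrary \<open>c\<close>.\<close>
  have wB': "(LINT x|Q. w c x * indicator B (X x))
      = measure Q ?CB + Re (c * (CLINT x|Q. indicator ?CB x *\<^sub>R iexp (v x)))"
    if "finite_measure Q" and [measurable_cong]: "sets Q = sets M" for Q c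
  proof -
    interpret finite_measure Q by fact
    have sp: "space Q = space M" using that by (auto dest: sets_eq_imp_space_eq)
    have [measurable]: "?CB \<in> sets Q" by (simp add: that(2))
    have int: "integrable Q (\<lambda>x. indicator ?CB x *\<^sub>R iexp (v x))"
      by (intro integrable_const_bound[of _ 1]) (auto simp: indicator_def)
    have "(LINT x|Q. w c x * indicator B (X x))
        = (LINT x|Q. indicator ?CB x + Re (c * (indicator ?CB x *\<^sub>R iexp (v x))))"
      by (intro Bochner_Integration.integral_cong) (auto simp: w_def indicator_def sp)
    also have "\<dots> = (LINT x|Q. indicator ?CB x) + (LINT x|Q. Re (c * (indicator ?CB x *\<^sub>R iexp (v x))))"
      using int by (intro Bochner_Integration.integral_add integrable_Re integrable_mult_right)
        (auto intro!: integrable_const_bound[of _ 1] simp: indicator_def)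
    also have "(LINT x|Q. Re (c * (indicator ?CB x *\<^sub>R iexp (v x))))
        = Re (CLINT x|Q. c * (indicator ?CB x *\<^sub>R iexp (v x)))"
      using int by (intro integral_Re integrable_mult_right) auto
    also have "(CLINT x|Q. c * (indicator ?CB x *\<^sub>R iexp (v x))) = c * (CLINT x|Q. indicator ?CB x *\<^sub>R iexp (v x))"
      by (rule integral_mult_right_zero)
    finally show ?thesis
      by (simp add: Int_absorb1 sp)
  qed
  have *: "measure Q1 ?CB + Re (c * (CLINT x|Q1. indicator ?CB x *\<^sub>R iexp (v x)))
      = measure Q2 ?CB + Re (c * (CLINT x|Q2. indicator ?CB x *\<^sub>R iexp (v x)))" if "norm c \<le> 1" for c
    using wB[OF that] wB'[OF Q(1,3)] wB'[OF Q(2,4)] by simp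
  \<comment> \<open>c = 0 isolates the measure of the set, c = 1 then gives the real part, and
    \<open>c = - \<i>\<close> the imaginary part because Re(-iz) = Im z.\<close>
  show ?thesis
    using *[of 0] *[of 1] *[of "- \<i>"] by (intro complex_eqI) auto
qed

text \<open>Finite cylinders form an intersection-stable generator, so it is enough to treat them.
  Closure of \<open>V\<close> under linear combinations supplies s X + t v \<in> V, as required for
  adding the constraint X \<in> B to a cylinder.\<close>

lemma measure_eqI_char_linear_space:
  fixes V :: "('a \<Rightarrow> real) set"
  assumes Q: "finite_measure Q1" "finite_measure Q2" "sets Q1 = sets M" "sets Q2 = sets M"
    and V: "V \<subseteq> borel_measurable M" "(\<lambda>_. 0) \<in> V"
      "\<And>X Y a b. X \<in> V \<Longrightarrow> Y \<in> V \<Longrightarrow> (\<lambda>x. a * X x + b * Y x) \<in> V"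
    and eq: "\<And>v. v \<in> V \<Longrightarrow> (CLINT x|Q1. iexp (v x)) = (CLINT x|Q2. iexp (v x))"
    and A: "A \<in> sigma_sets (space M) {X -` B \<inter> space M |X B. X \<in> V \<and> B \<in> sets borel}"
  shows "measure Q1 A = measure Q2 A"
proof -
  interpret Q1: finite_measure Q1 by fact
  interpret Q2: finite_measure Q2 by fact
  have sp: "space Q1 = space M" "space Q2 = space M"
    using Q(3,4) by (auto dest: sets_eq_imp_space_eq)
  \<comment> \<open>Constraints form a set of pairs, so one variable may carry several sets
    \<open>B\<close> and intersecting cylinders is taking unions of constraint sets.\<close>
  define cyl where "cyl F = {x \<in> space M. \<forall>(X, B) \<in> F. X x \<in> B}" for F :: "(('a \<Rightarrow> real) \<times> real set) set"
  define E where "E = cyl ` {F. finite F \<and> F \<subseteq> V \<times> sets borel}"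
  \<comment> \<open>The induction needs the integrals against all \<open>v\<close>; equality of the
    measures alone would not propagate. It is recovered at v = 0.\<close>
  have good: "cyl F \<in> sets M \<and> (\<forall>v\<in>V. (CLINT x|Q1. indicator (cyl F) x *\<^sub>R iexp (v x))
      = (CLINT x|Q2. indicator (cyl F) x *\<^sub>R iexp (v x)))"
    if "finite F" "F \<subseteq> V \<times> sets borel" for F
    using that
  proof (induction F)
    case empty
    have "(CLINT x|Q. indicator (cyl {}) x *\<^sub>R iexp (v x)) = (CLINT x|Q. iexp (v x))"
      if "space Q = space M" for Q v
      using that by (intro Bochner_Integration.integral_cong) (auto simp: cyl_def)
    then show ?case using eq sp by (simp add: cyl_def)
  next
    case (insert p F)
    obtain X B where p: "p = (X, B)" by force
    have XB: "X \<in> V" "B \<in> sets borel" using insert.prems by (auto simp: p)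
    then have [measurable]: "X \<in> borel_measurable M" using V by auto
    have cyl: "cyl (insert p F) = cyl F \<inter> (X -` B \<inter> space M)"
      by (auto simp: cyl_def p)
    have IH: "cyl F \<in> sets M"
      "\<And>v. v \<in> V \<Longrightarrow> (CLINT x|Q1. indicator (cyl F) x *\<^sub>R iexp (v x))
      = (CLINT x|Q2. indicator (cyl F) x *\<^sub>R iexp (v x))"
      using insert by auto
    show ?case unfolding cyl
    proof (intro conjI ballI)
      show "cyl F \<inter> (X -` B \<inter> space M) \<in> sets M"
        using IH(1) XB by measurable
      fix v assume "v \<in> V"
      then show "(CLINT x|Q1. indicator (cyl F \<inter> (X -` B \<inter> space M)) x *\<^sub>R iexp (v x))
        = (CLINT x|Q2. indicator (cyl F \<inter> (X -` B \<inter> space M)) x *\<^sub>R iexp (v x))"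
        using V XB by (intro trig_integral_eq_Int_vimage Q IH V(3)) auto
    qed
  qed
  have E: "measure Q1 C = measure Q2 C \<and> C \<in> sets M" if "C \<in> E" for C
  proof -
    from that obtain F where F: "C = cyl F" "finite F" "F \<subseteq> V \<times> sets borel"
      by (auto simp: E_def)
    have C: "C \<in> sets M"
      "(CLINT x|Q1. indicator C x *\<^sub>R iexp 0) = (CLINT x|Q2. indicator C x *\<^sub>R iexp 0)"
      using good[OF F(2,3)] V(2) F(1) by auto
    have "(CLINT x|Q. indicator C x *\<^sub>R iexp 0) = complex_of_real (measure Q C)"
      if "sets Q = sets M" for Q
    proof -
      have "(CLINT x|Q. indicator C x *\<^sub>R iexp 0) = (CLINT x|Q. complex_of_real (indicator C x))"
        by (simp add: scaleR_conv_of_real)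
      also have "\<dots> = complex_of_real (measure Q C)"
        using C(1) that sets_eq_imp_space_eq[OF that] sets.sets_into_space[OF C(1)]
        by (simp add: Int_absorb2)
      finally show ?thesis .
    qed
    with C Q(3,4) show ?thesis by simp
  qed
  have A': "A \<in> sigma_sets (space M) E"
  proof (rule subsetD[OF sigma_sets_mono' A])
    show "{X -` B \<inter> space M |X B. X \<in> V \<and> B \<in> sets borel} \<subseteq> E"
    proof safe
      fix X :: "'a \<Rightarrow> real" and B :: "real set" assume "X \<in> V" "B \<in> sets borel"
      then show "X -` B \<inter> space M \<in> E"
        unfolding E_def by (intro image_eqI[of _ _ "{(X, B)}"]) (auto simp: cyl_def)
    qed
  qed
  have "Int_stable E"
  proof (rule Int_stableI)
    fix a b assume "a \<in> E" "b \<in> E"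
    then obtain F G where "a = cyl F" "finite F" "F \<subseteq> V \<times> sets borel"
        "b = cyl G" "finite G" "G \<subseteq> V \<times> sets borel"
      by (auto simp: E_def)
    then show "a \<inter> b \<in> E"
      unfolding E_def by (intro image_eqI[of _ _ "F \<union> G"]) (auto simp: cyl_def)
  qed
  moreover have "E \<subseteq> Pow (space M)" by (auto simp: E_def cyl_def)
  ultimately have "measure Q1 A = measure Q2 A \<and> A \<in> sets M"
    using A'
  proof (induction A rule: sigma_sets_induct_disjoint)
    case (basic C)
    then show ?case using E by blast
  next
    case (compl C)
    have "space M \<in> E"
      unfolding E_def by (intro image_eqI[of _ _ "{}"]) (auto simp: cyl_def)
    then have "measure Q1 (space M) = measure Q2 (space M)" using E by blast
    with compl show ?case
      using Q1.finite_measure_compl[of C] Q2.finite_measure_compl[of C] Q sp by auto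
  next
    case (union C)
    then have "range C \<subseteq> sets M" by auto
    then show ?case
      using union Q1.finite_measure_UNION[of C] Q2.finite_measure_UNION[of C] Q sums_unique
      by (fastforce simp: sums_iff)
  qed simp
  then show ?thesis ..
qed

section \<open>Gaussian Hilbert spaces\<close>

lemma centered_gaussian_square_integrable:
  assumes "prob_space M" "centered_gaussian M X"
  shows "integrable M (\<lambda>\<omega>. (X \<omega>)\<^sup>2)"
proof -
  interpret prob_space M by fact
  have [measurable]: "X \<in> borel_measurable M"
    using assms(2) by (simp add: centered_gaussian_def)
  consider "AE \<omega> in M. X \<omega> = 0" | \<sigma> where "\<sigma> > 0" "distributed M lborel X (normal_density 0 \<sigma>)"
    using assms(2) unfolding centered_gaussian_def by blast
  then show ?thesis
  proof cases
    case 1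
    then have "integrable M (\<lambda>\<omega>. (X \<omega>)\<^sup>2) \<longleftrightarrow> integrable M (\<lambda>\<omega>. 0 :: real)"
      by (intro integrable_cong_AE) auto
    then show ?thesis by simp
  next
    case 2
    then have "integrable lborel (\<lambda>x. normal_density 0 \<sigma> x * x\<^sup>2)"
      using integrable_normal_moment[of \<sigma> 0 2] by simp
    then show ?thesis
      using 2 distributed_integrable[OF 2(2), of "\<lambda>x. x\<^sup>2"] by simp
  qed
qed

lemma normal_distributed_second_moment:
  assumes "prob_space M" "\<sigma> > 0" "distributed M lborel X (normal_density 0 \<sigma>)"
  shows "(LINT \<omega>|M. (X \<omega>)\<^sup>2) = \<sigma>\<^sup>2"
  using prob_space.normal_distributed_variance[OF assms]
    prob_space.normal_distributed_expectation[OF assms] by simp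

text \<open>Formulated with the second moment instead of a parameter \<sigma>, which covers the
  degenerate variable as well: comparing characteristic functions becomes comparing second moments,
  without a case distinction.\<close>

lemma centered_gaussian_char:
  assumes "prob_space M" "centered_gaussian M X"
  shows "(CLINT \<omega>|M. iexp (X \<omega>)) = exp (- (LINT \<omega>|M. (X \<omega>)\<^sup>2) / 2)"
proof -
  interpret prob_space M by fact
  have [measurable]: "X \<in> borel_measurable M"
    using assms(2) by (simp add: centered_gaussian_def)
  consider "AE \<omega> in M. X \<omega> = 0" | \<sigma> where "\<sigma> > 0" "distributed M lborel X (normal_density 0 \<sigma>)"
    using assms(2) unfolding centered_gaussian_def by blast
  then show ?thesis
  proof cases
    case 1
    have "(CLINT \<omega>|M. iexp (X \<omega>)) = (CLINT \<omega>|M. 1)"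
      using 1 by (intro integral_cong_AE) auto
    moreover have "(LINT \<omega>|M. (X \<omega>)\<^sup>2) = (LINT \<omega>|M. 0)"
      using 1 by (intro integral_cong_AE) auto
    ultimately show ?thesis by (simp add: prob_space)
  next
    case 2
    have std: "distributed M lborel (\<lambda>\<omega>. X \<omega> / \<sigma>) std_normal_density"
      using 2 normal_standard_normal_convert[OF 2(1), of X 0] by simp
    have "(CLINT \<omega>|M. iexp (X \<omega>)) = (CLINT \<omega>|M. iexp (\<sigma> * (X \<omega> / \<sigma>)))"
      using 2 by simp
    also have "\<dots> = char (distr M lborel (\<lambda>\<omega>. X \<omega> / \<sigma>)) \<sigma>"
      unfolding char_def by (subst integral_distr) auto
    also have "\<dots> = exp (- \<sigma>\<^sup>2 / 2)"
      by (simp add: distributed_distr_eq_density[OF std] char_std_normal_distribution)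
    finally show ?thesis
      by (simp add: normal_distributed_second_moment[OF assms(1) 2])
  qed
qed

lemma centered_gaussian_distributed:
  assumes "prob_space M" "centered_gaussian M X" "(LINT \<omega>|M. (X \<omega>)\<^sup>2) = v" "v > 0"
  shows "distributed M lborel X (normal_density 0 (sqrt v))"
proof -
  have [measurable]: "X \<in> borel_measurable M"
    using assms(2) by (simp add: centered_gaussian_def)
  have "\<not> (AE \<omega> in M. X \<omega> = 0)"
  proof
    assume "AE \<omega> in M. X \<omega> = 0"
    then have "(LINT \<omega>|M. (X \<omega>)\<^sup>2) = (LINT \<omega>|M. 0)"
      by (intro integral_cong_AE) auto
    with assms show False by simp
  qed
  then obtain \<sigma> where \<sigma>: "\<sigma> > 0" "distributed M lborel X (normal_density 0 \<sigma>)"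
    using assms(2) unfolding centered_gaussian_def by blast
  with normal_distributed_second_moment[OF assms(1) \<sigma>] assms(3) have "\<sigma> = sqrt v"
    by (simp add: real_sqrt_unique)
  with \<sigma> show ?thesis by simp
qed

section \<open>Orthogonality and independence inside a Gaussian Hilbert space\<close>

context
  fixes M :: "'w measure" and G :: "('w \<Rightarrow> real) set"
  assumes G: "gaussian_hilbert_space M G"
begin

interpretation prob_space M
  using G by (simp add: gaussian_hilbert_space_def)

lemma ghs_gaussian: "X \<in> G \<Longrightarrow> centered_gaussian M X"
  using G by (simp add: gaussian_hilbert_space_def)

lemma ghs_measurable: "X \<in> G \<Longrightarrow> X \<in> borel_measurable M"
  using ghs_gaussian by (simp add: centered_gaussian_def)

lemma ghs_lin: "X \<in> G \<Longrightarrow> Y \<in> G \<Longrightarrow> (\<lambda>\<omega>. a * X \<omega> + b * Y \<omega>) \<in> G"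
  using G by (simp add: gaussian_hilbert_space_def)

lemma ghs_diff: "X \<in> G \<Longrightarrow> Y \<in> G \<Longrightarrow> (\<lambda>\<omega>. X \<omega> - Y \<omega>) \<in> G"
  using ghs_lin[of X Y 1 "-1"] by simp

lemma ghs_sum:
  assumes "finite I" "\<And>i. i \<in> I \<Longrightarrow> X i \<in> G"
  shows "(\<lambda>\<omega>. \<Sum>i\<in>I. a i * X i \<omega>) \<in> G"
  using assms
proof (induction I)
  case empty
  then show ?case using G by (simp add: gaussian_hilbert_space_def)
next
  case (insert i I)
  then show ?case using ghs_lin[of "X i" "\<lambda>\<omega>. \<Sum>i\<in>I. a i * X i \<omega>" "a i" 1] by simp
qed

lemma ghs_char: "X \<in> G \<Longrightarrow> (CLINT \<omega>|M. iexp (X \<omega>)) = exp (- (LINT \<omega>|M. (X \<omega>)\<^sup>2) / 2)"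
  by (intro centered_gaussian_char ghs_gaussian prob_space_axioms)

lemma ghs_integrable_square: "X \<in> G \<Longrightarrow> integrable M (\<lambda>\<omega>. (X \<omega>)\<^sup>2)"
  by (intro centered_gaussian_square_integrable ghs_gaussian prob_space_axioms)

lemma ghs_integrable: "X \<in> G \<Longrightarrow> integrable M X"
  by (rule square_integrable_imp_integrable[OF ghs_measurable ghs_integrable_square])

lemma ghs_integrable_mult:
  assumes "X \<in> G" "Y \<in> G"
  shows "integrable M (\<lambda>\<omega>. X \<omega> * Y \<omega>)"
proof -
  note [measurable] = assms[THEN ghs_measurable]
  have "\<bar>X \<omega> * Y \<omega>\<bar> \<le> (X \<omega>)\<^sup>2 + (Y \<omega>)\<^sup>2" for \<omega>
    using zero_le_power2[of "\<bar>X \<omega>\<bar> - \<bar>Y \<omega>\<bar>"] mult_nonneg_nonneg[of "\<bar>X \<omega>\<bar>" "\<bar>Y \<omega>\<bar>"]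
    unfolding power2_diff abs_mult power2_abs by linarith
  then have bound: "norm (X \<omega> * Y \<omega>) \<le> norm ((X \<omega>)\<^sup>2 + (Y \<omega>)\<^sup>2)" for \<omega>
    unfolding real_norm_def using abs_ge_self order_trans by blast
  show ?thesis
  proof (rule Bochner_Integration.integrable_bound)
    show "integrable M (\<lambda>\<omega>. (X \<omega>)\<^sup>2 + (Y \<omega>)\<^sup>2)"
      using assms[THEN ghs_integrable_square] by simp
    show "AE \<omega> in M. norm (X \<omega> * Y \<omega>) \<le> norm ((X \<omega>)\<^sup>2 + (Y \<omega>)\<^sup>2)"
      using bound by (intro AE_I2)
  qed simp
qed

lemma ghs_lin_mult:
  assumes "X \<in> G" "Y \<in> G" "Z \<in> G"
  shows "(LINT \<omega>|M. Z \<omega> * (a * X \<omega> + b * Y \<omega>)) = a * (LINT \<omega>|M. Z \<omega> * X \<omega>) + b * (LINT \<omega>|M. Z \<omega> * Y \<omega>)"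
proof -
  have "(LINT \<omega>|M. Z \<omega> * (a * X \<omega> + b * Y \<omega>)) = (LINT \<omega>|M. a * (Z \<omega> * X \<omega>) + b * (Z \<omega> * Y \<omega>))"
    by (simp add: algebra_simps)
  then show ?thesis
    using assms by (simp add: ghs_integrable_mult)
qed

text \<open>Pythagoras. Only the square of \<open>b\<close> occurs on the right, so the sign of
  \<open>b\<close> does not affect the characteristic function of the combination.\<close>

lemma ghs_second_moment_lin:
  assumes "X \<in> G" "Y \<in> G" "(LINT \<omega>|M. X \<omega> * Y \<omega>) = 0"
  shows "(LINT \<omega>|M. (a * X \<omega> + b * Y \<omega>)\<^sup>2) = a\<^sup>2 * (LINT \<omega>|M. (X \<omega>)\<^sup>2) + b\<^sup>2 * (LINT \<omega>|M. (Y \<omega>)\<^sup>2)"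
proof -
  have "(LINT \<omega>|M. (a * X \<omega> + b * Y \<omega>)\<^sup>2)
      = (LINT \<omega>|M. a\<^sup>2 * (X \<omega>)\<^sup>2 + b\<^sup>2 * (Y \<omega>)\<^sup>2 + 2 * a * b * (X \<omega> * Y \<omega>))"
    by (intro Bochner_Integration.integral_cong refl) (simp add: power2_sum power_mult_distrib)
  then show ?thesis
    using assms by (simp add: ghs_integrable_mult ghs_integrable_square)
qed

text \<open>For \<open>X\<close> orthogonal to \<open>V\<close> the variables \<open>v + s X\<close> and \<open>v - s X\<close> have the same variance, so
  weighting with \<open>1 + sin (s X)\<close> does not change the characteristic functions of elements of \<open>V\<close>.
  The truncations \<open>n sin (X / n)\<close> then recover \<open>X\<close> in the limit.\<close>

lemma ghs_orthogonal_integral_eq_0: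
  assumes X: "X \<in> G" and "V \<subseteq> G" and orth: "\<And>Y. Y \<in> V \<Longrightarrow> (LINT \<omega>|M. X \<omega> * Y \<omega>) = 0"
    and A: "A \<in> sigma_sets (space M) {Y -` B \<inter> space M |Y B. Y \<in> V \<and> B \<in> sets borel}"
  shows "(LINT \<omega>:A|M. X \<omega>) = 0"
proof -
  \<comment> \<open>\<open>V\<close> need not be a linear space of functions; the image of a space
    under \<open>h\<close> is one only up to null sets. The full orthogonal complement of
    \<open>X\<close> in \<open>G\<close> is linear and contains \<open>V\<close>.\<close>
  define V' where "V' = {Y \<in> G. (LINT \<omega>|M. X \<omega> * Y \<omega>) = 0}"
  have V': "V' \<subseteq> borel_measurable M" "(\<lambda>_. 0) \<in> V'"
      "\<And>Y Z a b. Y \<in> V' \<Longrightarrow> Z \<in> V' \<Longrightarrow> (\<lambda>x. a * Y x + b * Z x) \<in> V'"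
    using X ghs_lin ghs_lin_mult ghs_sum[of "{}"] by (auto simp: V'_def ghs_measurable)
  have [measurable]: "X \<in> borel_measurable M" using X by (rule ghs_measurable)
  have A': "A \<in> sigma_sets (space M) {Y -` B \<inter> space M |Y B. Y \<in> V' \<and> B \<in> sets borel}"
    using assms(2) orth by (intro subsetD[OF sigma_sets_mono' A]) (auto simp: V'_def)
  have [measurable]: "A \<in> sets M"
  proof (rule subsetD[OF sets.sigma_sets_subset A'])
    show "{Y -` B \<inter> space M |Y B. Y \<in> V' \<and> B \<in> sets borel} \<subseteq> sets M"
      using V'(1) by (auto intro!: measurable_sets)
  qed
  have sin0: "(LINT \<omega>:A|M. sin (s * X \<omega>)) = 0" for s
  proof -
    define Q where "Q = density M (\<lambda>\<omega>. ennreal (1 + sin (s * X \<omega>)))"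
    have nonneg: "0 \<le> 1 + sin (s * X \<omega>)" for \<omega>
      using sin_ge_minus_one[of "s * X \<omega>"] by linarith
    have int: "integrable M (\<lambda>\<omega>. 1 + sin (s * X \<omega>))"
      by (intro Bochner_Integration.integrable_add integrable_const integrable_const_bound[of _ 1]) auto
    have "emeasure Q (space M) = (\<integral>\<^sup>+\<omega>. ennreal (1 + sin (s * X \<omega>)) \<partial>M)"
      unfolding Q_def by (subst emeasure_density) (auto intro!: nn_integral_cong)
    also have "\<dots> = ennreal (LINT \<omega>|M. 1 + sin (s * X \<omega>))"
      by (intro nn_integral_eq_integral int) (simp add: nonneg)
    finally have "emeasure Q (space M) \<noteq> \<infinity>"
      by simp
    then have Q: "finite_measure Q"
      by (intro finite_measureI) (simp add: Q_def)
    \<comment> \<open>As \<open>Q\<close> has density 1 + sin(sX), this equality says that sin(sX)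
      integrates to 0 over \<open>A\<close>.\<close>
    have "measure Q A = measure M A"
    proof (rule measure_eqI_char_linear_space[OF Q finite_measure_axioms _ refl V' _ A'])
      fix v assume "v \<in> V'"
      then have v: "v \<in> G" "(LINT \<omega>|M. v \<omega> * X \<omega>) = 0" by (auto simp: V'_def mult.commute)
      note [measurable] = ghs_measurable[OF v(1)]
      have int': "integrable M (\<lambda>\<omega>. iexp (1 * v \<omega> + t * X \<omega>))" for t
        by (intro integrable_const_bound[of _ 1]) auto
      have "(CLINT \<omega>|Q. iexp (v \<omega>)) = (CLINT \<omega>|M. (1 + sin (s * X \<omega>)) *\<^sub>R iexp (v \<omega>))"
        unfolding Q_def by (subst integral_density) (auto simp: nonneg)
      also have "\<dots> = (CLINT \<omega>|M. iexp (1 * v \<omega> + 0 * X \<omega>)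
          + 1 / (2 * \<i>) * (iexp (1 * v \<omega> + s * X \<omega>) - iexp (1 * v \<omega> + (- s) * X \<omega>)))"
      proof (rule Bochner_Integration.integral_cong[OF refl])
        fix \<omega>
        have "complex_of_real (sin (s * X \<omega>)) = (iexp (s * X \<omega>) - iexp ((- s) * X \<omega>)) / (2 * \<i>)"
          by (simp add: sin_of_real[symmetric] sin_exp_eq)
        then have sin: "complex_of_real (1 + sin (s * X \<omega>)) = 1 + (iexp (s * X \<omega>) - iexp ((- s) * X \<omega>)) / (2 * \<i>)"
          by (simp only: of_real_add of_real_1)
        have add: "iexp (1 * v \<omega> + t * X \<omega>) = iexp (v \<omega>) * iexp (t * X \<omega>)" for t
          by (simp add: exp_add distrib_left)
        have "(1 + (p - q) / (2 * \<i>)) * a = a * 1 + 1 / (2 * \<i>) * (a * p - a * q)" for a p q :: complex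
          by (simp add: field_simps)
        from this[of "iexp (s * X \<omega>)" "iexp ((- s) * X \<omega>)" "iexp (v \<omega>)"]
        show "(1 + sin (s * X \<omega>)) *\<^sub>R iexp (v \<omega>) = iexp (1 * v \<omega> + 0 * X \<omega>)
          + 1 / (2 * \<i>) * (iexp (1 * v \<omega> + s * X \<omega>) - iexp (1 * v \<omega> + (- s) * X \<omega>))"
          unfolding scaleR_conv_of_real sin add by simp
      qed
      also have "\<dots> = (CLINT \<omega>|M. iexp (1 * v \<omega> + 0 * X \<omega>))
          + 1 / (2 * \<i>) * ((CLINT \<omega>|M. iexp (1 * v \<omega> + s * X \<omega>)) - (CLINT \<omega>|M. iexp (1 * v \<omega> + (- s) * X \<omega>)))"
        by (simp only: Bochner_Integration.integral_add Bochner_Integration.integral_diff integral_mult_right_zero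
            integrable_mult_right Bochner_Integration.integrable_add Bochner_Integration.integrable_diff int')
      also have "(CLINT \<omega>|M. iexp (1 * v \<omega> + s * X \<omega>)) = (CLINT \<omega>|M. iexp (1 * v \<omega> + (- s) * X \<omega>))"
        using ghs_char[OF ghs_lin[OF v(1) X, of 1 s]] ghs_char[OF ghs_lin[OF v(1) X, of 1 "-s"]]
        unfolding ghs_second_moment_lin[OF v(1) X v(2)] by simp
      finally show "(CLINT \<omega>|Q. iexp (v \<omega>)) = (CLINT \<omega>|M. iexp (v \<omega>))"
        by simp
    qed (simp add: Q_def)
    moreover have "measure Q A = (LINT \<omega>|M. indicator A \<omega> * (1 + sin (s * X \<omega>)))"
    proof -
      have "measure Q A = (LINT \<omega>|Q. indicator A \<omega>)" by (simp add: Q_def)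
      also have "\<dots> = (LINT \<omega>|M. (1 + sin (s * X \<omega>)) *\<^sub>R indicator A \<omega>)"
        unfolding Q_def by (subst integral_density) (auto simp: nonneg)
      finally show ?thesis by (simp add: mult.commute)
    qed
    moreover have "\<dots> = (LINT \<omega>|M. indicator A \<omega> + indicator A \<omega> * sin (s * X \<omega>))"
      by (simp add: algebra_simps)
    moreover have "\<dots> = (LINT \<omega>|M. indicator A \<omega>) + (LINT \<omega>|M. indicator A \<omega> * sin (s * X \<omega>))"
      by (intro Bochner_Integration.integral_add integrable_const_bound[of _ 1])
        (auto simp: indicator_def)
    ultimately show ?thesis
      by (simp add: set_lebesgue_integral_def)
  qed
  have "(\<lambda>n. LINT \<omega>|M. indicator A \<omega> * (real n * sin (1 / real n * X \<omega>))) \<longlonglongrightarrow> (LINT \<omega>|M. indicator A \<omega> * X \<omega>)"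
  proof (rule integral_dominated_convergence[where w = "\<lambda>\<omega>. \<bar>X \<omega>\<bar>"])
    show "integrable M (\<lambda>\<omega>. \<bar>X \<omega>\<bar>)" using ghs_integrable[OF X] by simp
    have "(\<lambda>n. real n * sin (1 / real n * x)) \<longlonglongrightarrow> x" for x :: real
      by real_asymp
    then show "AE \<omega> in M. (\<lambda>n. indicator A \<omega> * (real n * sin (1 / real n * X \<omega>))) \<longlonglongrightarrow> indicator A \<omega> * X \<omega>"
      by (intro AE_I2 tendsto_intros)
    \<comment> \<open>The inequality |sin y| \<le> |y| at y = x/n; for n = 0 the term is 0.\<close>
    have "\<bar>real n * sin (1 / real n * x)\<bar> \<le> \<bar>x\<bar>" for n x
      using mult_left_mono[OF abs_sin_x_le_abs_x[of "1 / real n * x"], of "real n"]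
      by (cases "n = 0") (auto simp: abs_mult)
    then show "AE \<omega> in M. norm (indicator A \<omega> * (real n * sin (1 / real n * X \<omega>))) \<le> \<bar>X \<omega>\<bar>" for n
      by (auto simp: indicator_def)
  qed auto
  moreover have "(LINT \<omega>|M. indicator A \<omega> * (real n * sin (1 / real n * X \<omega>))) = 0" for n
    using sin0[of "1 / real n"]
    by (subst mult.left_commute) (simp add: set_lebesgue_integral_def)
  ultimately show ?thesis
    by (simp add: set_lebesgue_integral_def LIMSEQ_const_iff)
qed

text \<open>The joint law and the product of the marginal laws are compared on linear functionals of
  the coordinates. Second moments of orthogonal variables add, so the Gaussian characteristic
  function of such a functional factorises. Variables of variance 0 are allowed.\<close>

lemma ghs_orthogonal_indep_vars:
  fixes X :: "'i \<Rightarrow> 'w \<Rightarrow> real"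
  assumes "finite I" and X: "\<And>i. i \<in> I \<Longrightarrow> X i \<in> G"
    and orth: "\<And>i j. i \<in> I \<Longrightarrow> j \<in> I \<Longrightarrow> i \<noteq> j \<Longrightarrow> (LINT \<omega>|M. X i \<omega> * X j \<omega>) = 0"
  shows "indep_vars (\<lambda>_. borel) X I"
proof (cases "I = {}")
  case True
  then show ?thesis by (simp add: indep_vars_def indep_sets_def)
next
  case False
  have meas: "X i \<in> borel_measurable M" if "i \<in> I" for i
    using X that by (intro ghs_measurable)
  let ?P = "Pi\<^sub>M I (\<lambda>_. borel :: real measure)"
  define J where "J = distr M ?P (\<lambda>\<omega>. \<lambda>i\<in>I. X i \<omega>)"
  \<comment> \<open>Outside \<open>I\<close> the law of the constant 0 is a filler, so that every
    \<open>N i\<close> is a probability measure.\<close>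
  define N where "N i = distr M borel (if i \<in> I then X i else (\<lambda>_. 0))" for i
  define V :: "(('i \<Rightarrow> real) \<Rightarrow> real) set" where "V = {\<lambda>x. \<Sum>i\<in>I. a i * x i |a. True}"
  have N: "prob_space (N i)" for i
    unfolding N_def using meas by (intro prob_space_distr) auto
  interpret N: product_prob_space N I
    using N by (intro product_prob_spaceI) 
  interpret N: finite_product_prob_space N I
    by standard fact
  interpret J: prob_space J
    unfolding J_def using meas by (intro prob_space_distr measurable_restrict) auto
  have PiN: "Pi\<^sub>M I (\<lambda>i. distr M borel (X i)) = Pi\<^sub>M I N"
    by (intro PiM_cong) (auto simp: N_def)
  have setsN: "sets (Pi\<^sub>M I N) = sets ?P"
    by (intro sets_PiM_cong) (auto simp: N_def)
  have sets_J: "sets J = sets ?P"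
    by (simp add: J_def)
  have spP: "space ?P = (\<Pi>\<^sub>E i\<in>I. space borel)"
    by (simp add: space_PiM)
  have VM: "V \<subseteq> borel_measurable ?P"
    by (auto simp: V_def)
  have Vlin: "(\<lambda>x. a * Y x + b * Z x) \<in> V" if "Y \<in> V" "Z \<in> V" for Y Z a b
  proof -
    from that obtain c d where "Y = (\<lambda>x. \<Sum>i\<in>I. c i * x i)" "Z = (\<lambda>x. \<Sum>i\<in>I. d i * x i)"
      by (auto simp: V_def)
    then have "(\<lambda>x. a * Y x + b * Z x) = (\<lambda>x. \<Sum>i\<in>I. (a * c i + b * d i) * x i)"
      by (simp add: fun_eq_iff sum_distrib_left sum.distrib algebra_simps)
    then show ?thesis by (auto simp: V_def)
  qed
  have V0: "(\<lambda>_. 0) \<in> V"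
    unfolding V_def by (auto intro!: exI[of _ "\<lambda>_. 0"])
  have sm: "(LINT \<omega>|M. (\<Sum>i\<in>K. a i * X i \<omega>)\<^sup>2) = (\<Sum>i\<in>K. (a i)\<^sup>2 * (LINT \<omega>|M. (X i \<omega>)\<^sup>2))"
    if "K \<subseteq> I" for a K
    using finite_subset[OF that assms(1)] that
  proof (induction K)
    case (insert i K)
    have *: "(\<lambda>\<omega>. \<Sum>i\<in>K. a i * X i \<omega>) \<in> G" "X i \<in> G"
      using insert X by (auto intro!: ghs_sum)
    have "(LINT \<omega>|M. X i \<omega> * (\<Sum>i\<in>K. a i * X i \<omega>)) = (\<Sum>j\<in>K. (LINT \<omega>|M. a j * (X i \<omega> * X j \<omega>)))"
      using insert X unfolding sum_distrib_left
      by (subst Bochner_Integration.integral_sum[symmetric])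
        (auto intro!: ghs_integrable_mult Bochner_Integration.integral_cong sum.cong integrable_mult_right simp del: integral_mult_right_zero)
    also have "\<dots> = 0"
      using insert by (intro sum.neutral) (auto intro!: orth)
    finally show ?case
      using insert ghs_second_moment_lin[OF *(2,1), of "a i" 1] by simp
  qed simp
  \<comment> \<open>The exponential turns the sum of second moments into a product over
    \<open>I\<close>, which Fubini identifies with the integral over the product measure.\<close>
  have char: "(CLINT x|J. iexp (v x)) = (CLINT x|Pi\<^sub>M I N. iexp (v x))" if "v \<in> V" for v
  proof -
    from that obtain a where v: "v = (\<lambda>x. \<Sum>i\<in>I. a i * x i)" by (auto simp: V_def)
    have "(CLINT x|J. iexp (v x)) = (CLINT \<omega>|M. iexp (\<Sum>i\<in>I. a i * X i \<omega>))"
      unfolding J_def v using meas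
      by (subst integral_distr) (auto intro!: measurable_restrict)
    also have "\<dots> = exp (- (\<Sum>i\<in>I. (a i)\<^sup>2 * (LINT \<omega>|M. (X i \<omega>)\<^sup>2)) / 2)"
      by (subst ghs_char) (auto intro!: ghs_sum X assms(1) simp: sm)
    also have "\<dots> = complex_of_real (\<Prod>i\<in>I. exp (- ((a i)\<^sup>2 * (LINT \<omega>|M. (X i \<omega>)\<^sup>2)) / 2))"
      using assms(1) by (simp add: exp_sum[symmetric] sum_negf sum_divide_distrib)
    also have "\<dots> = (\<Prod>i\<in>I. (CLINT x|N i. iexp (a i * x)))"
      unfolding of_real_prod
    proof (intro prod.cong refl)
      fix i assume i: "i \<in> I"
      have "(CLINT x|N i. iexp (a i * x)) = (CLINT \<omega>|M. iexp (a i * X i \<omega> + 0 * X i \<omega>))"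
        using i meas[OF i] unfolding N_def by (subst integral_distr) auto
      also have "\<dots> = complex_of_real (exp (- ((a i)\<^sup>2 * (LINT \<omega>|M. (X i \<omega>)\<^sup>2)) / 2))"
        by (subst ghs_char[OF ghs_lin[OF X[OF i] X[OF i]]]) (simp add: power_mult_distrib)
      finally show "complex_of_real (exp (- ((a i)\<^sup>2 * (LINT \<omega>|M. (X i \<omega>)\<^sup>2)) / 2)) = (CLINT x|N i. iexp (a i * x))"
        by simp
    qed
    also have "\<dots> = (CLINT x|Pi\<^sub>M I N. (\<Prod>i\<in>I. iexp (a i * x i)))"
    proof (rule N.product_integral_prod[symmetric, OF assms(1)])
      show "integrable (N i) (\<lambda>x. iexp (a i * x))" for i
        by (rule finite_measure.integrable_const_bound[OF prob_space.finite_measure[OF N], of _ 1])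
           (auto simp: N_def)
    qed
    also have "\<dots> = (CLINT x|Pi\<^sub>M I N. iexp (v x))"
      using assms(1) by (simp add: v exp_sum sum_distrib_left)
    finally show ?thesis .
  qed
  have "J = Pi\<^sub>M I N"
  proof (rule measure_eqI)
    show "sets J = sets (Pi\<^sub>M I N)" by (simp add: sets_J setsN)
    fix A assume "A \<in> sets J"
    then have "A \<in> sigma_sets (space ?P)
        {{f \<in> \<Pi>\<^sub>E i\<in>I. space borel. f i \<in> B} |i B. i \<in> I \<and> B \<in> sets borel}"
      unfolding spP by (simp add: sets_J sets_PiM_single)
    moreover have "{{f \<in> \<Pi>\<^sub>E i\<in>I. space borel. f i \<in> B} |i B. i \<in> I \<and> B \<in> sets (borel :: real measure)}
        \<subseteq> {v -` B \<inter> space ?P |v B. v \<in> V \<and> B \<in> sets borel}"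
    proof clarify
      fix i and B :: "real set" assume "i \<in> I" "B \<in> sets borel"
      moreover from \<open>i \<in> I\<close> have "(\<lambda>x. x i) \<in> V"
        unfolding V_def using assms(1)
        by (auto intro!: exI[of _ "\<lambda>j. if j = i then 1 else 0"] simp: if_distrib[of "\<lambda>c. c * _"] sum.delta cong: if_cong)
      ultimately show "\<exists>v B'. {f \<in> \<Pi>\<^sub>E i\<in>I. space borel. f i \<in> B} = v -` B' \<inter> space ?P \<and> v \<in> V \<and> B' \<in> sets borel"
        by (intro exI[of _ "\<lambda>x. x i"] exI[of _ B]) (auto simp: spP)
    qed
    ultimately have "A \<in> sigma_sets (space ?P) {v -` B \<inter> space ?P |v B. v \<in> V \<and> B \<in> sets borel}"
      using sigma_sets_mono' by blast
    then have "measure J A = measure (Pi\<^sub>M I N) A"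
      using VM V0 Vlin char
      by (intro measure_eqI_char_linear_space[of J "Pi\<^sub>M I N" ?P V]
          J.finite_measure_axioms N.P.finite_measure_axioms) (auto simp: setsN sets_J)
    then show "emeasure J A = emeasure (Pi\<^sub>M I N) A"
      by (simp add: J.emeasure_eq_measure N.P.emeasure_eq_measure)
  qed
  then show ?thesis
    using False meas by (subst indep_vars_iff_distr_eq_PiM') (auto simp: J_def PiN)
qed

end

section \<open>Laws of processes with independent Gaussian increments\<close>

text \<open>The empty index set is included because a marginal at times in {0} involves no
  increments; both sides are then the probability measure on a one-point space.\<close>

lemma (in prob_space) indep_vars_imp_distr_eq_PiM:
  assumes "finite I" "indep_vars M' X I"
  shows "distr M (\<Pi>\<^sub>M i\<in>I. M' i) (\<lambda>x. \<lambda>i\<in>I. X i x) = (\<Pi>\<^sub>M i\<in>I. distr M (M' i) (X i))"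
proof (cases "I = {}")
  case True
  show ?thesis
    unfolding True
  proof (rule measure_eqI)
    fix A assume "A \<in> sets (distr M (Pi\<^sub>M {} M') (\<lambda>x. \<lambda>i\<in>{}. X i x))"
    then have "A = {} \<or> A = {\<lambda>_. undefined}" by (simp add: sets_PiM_empty)
    then show "emeasure (distr M (Pi\<^sub>M {} M') (\<lambda>x. \<lambda>i\<in>{}. X i x)) A
        = emeasure (\<Pi>\<^sub>M i\<in>{}. distr M (M' i) (X i)) A"
      by (auto simp: PiM_empty emeasure_distr emeasure_space_1 restrict_def vimage_def)
  qed (simp add: sets_PiM_empty)
next
  case False
  moreover have "random_variable (M' i) (X i)" if "i \<in> I" for i
    using assms that by (simp add: indep_vars_def)
  ultimately show ?thesis
    using assms by (simp add: indep_vars_iff_distr_eq_PiM')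
qed

text \<open>The right-hand side depends on the grid and on \<open>k\<close> but not on the process,
  so it links processes on different probability spaces. The grid is strictly increasing because
  \<open>brownian_fdd\<close> prescribes a normal density only for increments of positive
  length.\<close>

lemma brownian_fdd_finite_marginal:
  fixes X :: "real \<Rightarrow> 'w \<Rightarrow> real"
  assumes X: "brownian_fdd M T X" and J: "finite J"
    and \<tau>: "\<tau> 0 = 0" "\<And>i. i < n \<Longrightarrow> \<tau> i < \<tau> (Suc i)" "\<And>i. i \<le> n \<Longrightarrow> \<tau> i \<in> {0..T}"
    and k: "\<And>t. t \<in> J \<Longrightarrow> k t \<le> n \<and> \<tau> (k t) = t"
  shows "distr M (Pi\<^sub>M J (\<lambda>_. borel)) (\<lambda>\<omega>. \<lambda>t\<in>J. X t \<omega>) =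
    distr (\<Pi>\<^sub>M i\<in>{..<n}. density lborel (normal_density 0 (sqrt (\<tau> (Suc i) - \<tau> i))))
      (Pi\<^sub>M J (\<lambda>_. borel)) (\<lambda>x. \<lambda>t\<in>J. \<Sum>i<k t. x i)"
proof -
  interpret prob_space M using X by (simp add: brownian_fdd_def)
  define Y where "Y i \<omega> = X (\<tau> (Suc i)) \<omega> - X (\<tau> i) \<omega>" for i \<omega>
  have Xm: "X t \<in> borel_measurable M" if "t \<in> {0..T}" for t
    using X that by (simp add: brownian_fdd_def)
  have Ym [measurable]: "Y i \<in> borel_measurable M" if "i < n" for i
    unfolding Y_def[abs_def] using that \<tau>(3)[of i] \<tau>(3)[of "Suc i"] by (intro borel_measurable_diff Xm) auto
  have X0: "AE \<omega> in M. X 0 \<omega> = 0" using X by (simp add: brownian_fdd_def)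
  have indep: "indep_vars (\<lambda>_. borel) Y {..<n}"
    using X \<tau> unfolding brownian_fdd_def Y_def[abs_def] by (simp add: less_imp_le)
  have Yd: "distr M borel (Y i) = density lborel (normal_density 0 (sqrt (\<tau> (Suc i) - \<tau> i)))"
    if "i < n" for i
  proof -
    have "0 \<le> \<tau> i" "\<tau> i < \<tau> (Suc i)" "\<tau> (Suc i) \<le> T"
      using \<tau>(2)[OF that] \<tau>(3)[of i] \<tau>(3)[of "Suc i"] that by auto
    then have "distributed M lborel (Y i) (normal_density 0 (sqrt (\<tau> (Suc i) - \<tau> i)))"
      using X unfolding brownian_fdd_def Y_def[abs_def] by blast
    then show ?thesis
      using distributed_distr_eq_density distr_cong[of M M borel lborel] by (metis sets_lborel)
  qed
  have Pi: "distr M (\<Pi>\<^sub>M i\<in>{..<n}. borel) (\<lambda>\<omega>. \<lambda>i\<in>{..<n}. Y i \<omega>)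
      = (\<Pi>\<^sub>M i\<in>{..<n}. density lborel (normal_density 0 (sqrt (\<tau> (Suc i) - \<tau> i))))"
    unfolding indep_vars_imp_distr_eq_PiM[OF finite_lessThan indep]
    by (intro PiM_cong) (auto simp: Yd)
  have sum_meas: "(\<lambda>x. \<lambda>t\<in>J. \<Sum>i<k t. x i) \<in> measurable (\<Pi>\<^sub>M i\<in>{..<n}. borel) (Pi\<^sub>M J (\<lambda>_. borel :: real measure))"
    using k by (intro measurable_restrict borel_measurable_sum measurable_component_singleton) fastforce
  \<comment> \<open>The increments with i < k t telescope to X t - X 0, and X 0 vanishes almost
    surely.\<close>
  have "AE \<omega> in M. (\<lambda>t\<in>J. X t \<omega>) = (\<lambda>t\<in>J. \<Sum>i<k t. Y i \<omega>)"
    using X0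
  proof eventually_elim
    case (elim \<omega>)
    then show ?case
      using k sum_lessThan_telescope[of "\<lambda>i. X (\<tau> i) \<omega>"] \<tau>(1)
      by (auto simp: Y_def fun_eq_iff restrict_def)
  qed
  moreover have "(\<lambda>\<omega>. \<lambda>t\<in>J. X t \<omega>) \<in> measurable M (Pi\<^sub>M J (\<lambda>_. borel))"
    using k \<tau>(3) by (intro measurable_restrict Xm) metis
  moreover have "(\<lambda>\<omega>. \<lambda>t\<in>J. \<Sum>i<k t. Y i \<omega>) \<in> measurable M (Pi\<^sub>M J (\<lambda>_. borel))"
    using k by (intro measurable_restrict borel_measurable_sum Ym) fastforce
  ultimately have "distr M (Pi\<^sub>M J (\<lambda>_. borel)) (\<lambda>\<omega>. \<lambda>t\<in>J. X t \<omega>)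
      = distr M (Pi\<^sub>M J (\<lambda>_. borel)) (\<lambda>\<omega>. \<lambda>t\<in>J. \<Sum>i<k t. Y i \<omega>)"
    by (intro distr_cong_AE) auto
  also have "\<dots> = distr M (Pi\<^sub>M J (\<lambda>_. borel)) ((\<lambda>x. \<lambda>t\<in>J. \<Sum>i<k t. x i) \<circ> (\<lambda>\<omega>. \<lambda>i\<in>{..<n}. Y i \<omega>))"
    using k by (intro distr_cong) (fastforce simp: fun_eq_iff restrict_def intro!: sum.cong)+
  also have "\<dots> = distr (distr M (\<Pi>\<^sub>M i\<in>{..<n}. borel) (\<lambda>\<omega>. \<lambda>i\<in>{..<n}. Y i \<omega>))
      (Pi\<^sub>M J (\<lambda>_. borel)) (\<lambda>x. \<lambda>t\<in>J. \<Sum>i<k t. x i)"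
    by (rule distr_distr[OF sum_meas, symmetric]) (intro measurable_restrict Ym, simp)
  finally show ?thesis unfolding Pi .
qed

text \<open>A finite measure on the product \<sigma>-algebra is determined by its values on
  cylinders over finitely many times, hence by the marginals computed above.\<close>

lemma brownian_fdd_process_law_unique:
  assumes X: "brownian_fdd M T X" and Y: "brownian_fdd N T Y" and "0 \<le> T"
  shows "process_law M T X = process_law N T Y"
proof -
  have marg: "distr M (Pi\<^sub>M J (\<lambda>_. borel)) (\<lambda>\<omega>. \<lambda>t\<in>J. X t \<omega>)
      = distr N (Pi\<^sub>M J (\<lambda>_. borel)) (\<lambda>\<omega>. \<lambda>t\<in>J. Y t \<omega>)" if J: "finite J" "J \<subseteq> {0..T}" for J
  proof -
    \<comment> \<open>The time 0 is inserted because the grid must start there even when 0 is not in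
      \<open>J\<close>.\<close>
    define l where "l = sorted_list_of_set (insert 0 J)"
    have l: "set l = insert 0 J" "sorted_wrt (<) l"
      unfolding l_def strict_sorted_iff using J
      by (simp_all only: set_sorted_list_of_set finite.insertI sorted_sorted_list_of_set distinct_sorted_list_of_set)
    then have "l \<noteq> []" by auto
    note l = l this
    have l0: "l ! 0 = 0"
    proof -
      obtain i where i: "i < length l" "l ! i = 0"
        using l(1) by (metis in_set_conv_nth insertI1)
      have "l ! 0 \<in> insert 0 J" using l nth_mem[of 0 l] by auto
      then have "0 \<le> l ! 0" using J by auto
      moreover have "l ! 0 \<le> l ! i"
        using sorted_wrt_nth_less[OF l(2), of 0 i] i by (cases i) auto
      ultimately show ?thesis using i by simp
    qed
    have "\<exists>i<length l. l ! i = t" if "t \<in> J" for t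
      using l(1) that by (metis in_set_conv_nth insertI2)
    then obtain k where k: "\<And>t. t \<in> J \<Longrightarrow> k t < length l \<and> l ! k t = t"
      by metis
    have 1: "l ! i < l ! Suc i" if "i < length l - 1" for i
      using sorted_wrt_nth_less[OF l(2), of i "Suc i"] that by simp
    have 2: "l ! i \<in> {0..T}" if "i \<le> length l - 1" for i
    proof -
      have "i < length l" using that l(3) by (cases l) auto
      then have "l ! i \<in> insert 0 J" using l(1) nth_mem by metis
      then show ?thesis using J \<open>0 \<le> T\<close> by auto
    qed
    have 3: "k t \<le> length l - 1 \<and> l ! k t = t" if "t \<in> J" for t
      using k[OF that] by auto
    show ?thesis
      by (rule trans[OF brownian_fdd_finite_marginal[OF X J(1), OF l0 1 2 3]
            brownian_fdd_finite_marginal[OF Y J(1), OF l0 1 2 3, symmetric]])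
  qed
  have emb: "emeasure (process_law M T X) (prod_emb {0..T} (\<lambda>_. borel) J (Pi\<^sub>E J A))
      = emeasure (distr M (Pi\<^sub>M J (\<lambda>_. borel)) (\<lambda>\<omega>. \<lambda>t\<in>J. X t \<omega>)) (Pi\<^sub>E J A)"
    if J: "finite J" "J \<subseteq> {0..T}" and A: "\<And>i. i \<in> J \<Longrightarrow> A i \<in> sets borel" and X: "brownian_fdd M T X"
    for M :: "'x measure" and X J A
  proof -
    have Xm: "X t \<in> borel_measurable M" if "t \<in> {0..T}" for t
      using X that by (simp add: brownian_fdd_def)
    have Xr: "(\<lambda>\<omega>. \<lambda>t\<in>S. X t \<omega>) \<in> measurable M (Pi\<^sub>M S (\<lambda>_. borel))" if "S \<subseteq> {0..T}" for S
      using that by (intro measurable_restrict Xm) auto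
    have PJ: "Pi\<^sub>E J A \<in> sets (Pi\<^sub>M J (\<lambda>_. borel))"
      using J A by (intro sets_PiM_I_finite) auto
    have "(\<lambda>\<omega>. \<lambda>t\<in>{0..T}. X t \<omega>) -` prod_emb {0..T} (\<lambda>_. borel) J (Pi\<^sub>E J A) \<inter> space M
        = (\<lambda>\<omega>. \<lambda>t\<in>J. X t \<omega>) -` Pi\<^sub>E J A \<inter> space M"
      using J(2) by (auto simp: prod_emb_def Int_absorb1)
    moreover have "prod_emb {0..T} (\<lambda>_. borel) J (Pi\<^sub>E J A) \<in> sets (Pi\<^sub>M {0..T} (\<lambda>_. borel))"
      using PJ J(2) by (intro measurable_prod_emb)
    ultimately show ?thesis
      unfolding process_law_def using Xr[OF J(2)] Xr[OF order_refl] PJ by (simp add: emeasure_distr)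
  qed
  show ?thesis
  proof (rule measure_eqI_PiM_infinite)
    interpret prob_space M using X by (simp add: brownian_fdd_def)
    have "X t \<in> borel_measurable M" if "t \<in> {0..T}" for t
      using X that by (simp add: brownian_fdd_def)
    then show "finite_measure (process_law M T X)"
      unfolding process_law_def by (intro finite_measure_distr measurable_restrict)
  next
    fix A :: "real \<Rightarrow> real set" and J
    assume "finite J" "J \<subseteq> {0..T}" "\<And>i. i \<in> J \<Longrightarrow> A i \<in> sets borel"
    then show "emeasure (process_law M T X) (prod_emb {0..T} (\<lambda>_. borel) J (Pi\<^sub>E J A))
        = emeasure (process_law N T Y) (prod_emb {0..T} (\<lambda>_. borel) J (Pi\<^sub>E J A))"
      using emb[OF _ _ _ X] emb[OF _ _ _ Y] marg by simp
  qed (simp_all add: process_law_def)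
qed

text \<open>The covariance is min(s,t), which makes increments over non-overlapping intervals
  uncorrelated; inside \<open>G\<close> this already means independent.\<close>

lemma ghs_brownian_fdd:
  assumes G: "gaussian_hilbert_space M G" and W: "\<And>t. t \<in> {0..T} \<Longrightarrow> W t \<in> G"
    and cov: "\<And>s t. 0 \<le> s \<Longrightarrow> s \<le> t \<Longrightarrow> t \<le> T \<Longrightarrow> (LINT \<omega>|M. W s \<omega> * W t \<omega>) = s"
    and "0 \<le> T"
  shows "brownian_fdd M T W"
proof -
  interpret prob_space M using G by (simp add: gaussian_hilbert_space_def)
  have incr: "(LINT \<omega>|M. (W b \<omega> - W a \<omega>) * (W d \<omega> - W c \<omega>)) =
      (LINT \<omega>|M. W b \<omega> * W d \<omega>) - (LINT \<omega>|M. W b \<omega> * W c \<omega>)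
      - (LINT \<omega>|M. W a \<omega> * W d \<omega>) + (LINT \<omega>|M. W a \<omega> * W c \<omega>)"
    if "a \<in> {0..T}" "b \<in> {0..T}" "c \<in> {0..T}" "d \<in> {0..T}" for a b c d
  proof -
    have "(LINT \<omega>|M. (W b \<omega> - W a \<omega>) * (W d \<omega> - W c \<omega>)) =
        (LINT \<omega>|M. W b \<omega> * W d \<omega> - W b \<omega> * W c \<omega> - W a \<omega> * W d \<omega> + W a \<omega> * W c \<omega>)"
      by (simp add: algebra_simps)
    then show ?thesis
      using that by (simp add: ghs_integrable_mult[OF G] W)
  qed
  \<comment> \<open>Each of the four covariances is its earlier time: b - b - a + a = 0.\<close>
  have orth: "(LINT \<omega>|M. (W b \<omega> - W a \<omega>) * (W d \<omega> - W c \<omega>)) = 0"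
    if "0 \<le> a" "a \<le> b" "b \<le> c" "c \<le> d" "d \<le> T" for a b c d
    using that by (subst incr) (simp_all add: cov)
  show ?thesis
    unfolding brownian_fdd_def
  proof (intro conjI allI impI ballI)
    show "prob_space M" by (rule prob_space_axioms)
    show "W t \<in> borel_measurable M" if "t \<in> {0..T}" for t
      using W[OF that] by (rule ghs_measurable[OF G])
    have "(LINT \<omega>|M. (W 0 \<omega>)\<^sup>2) = 0"
      using cov[of 0 0] \<open>0 \<le> T\<close> by (simp add: power2_eq_square)
    then show "AE \<omega> in M. W 0 \<omega> = 0"
      using ghs_integrable_square[OF G W[of 0]] \<open>0 \<le> T\<close>
      by (subst (asm) integral_nonneg_eq_0_iff_AE) auto
  next
    fix s t :: real assume st: "0 \<le> s" "s < t" "t \<le> T"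
    have "(\<lambda>\<omega>. W t \<omega> - W s \<omega>) \<in> G"
      using st by (intro ghs_diff[OF G] W) auto
    moreover have "(LINT \<omega>|M. (W t \<omega> - W s \<omega>)\<^sup>2) = t - s"
    proof -
      have "(LINT \<omega>|M. W t \<omega> * W s \<omega>) = s"
        using cov[of s t] st by (simp add: mult.commute)
      then show ?thesis
        unfolding power2_eq_square using st by (subst incr) (simp_all add: cov)
    qed
    ultimately show "distributed M lborel (\<lambda>\<omega>. W t \<omega> - W s \<omega>) (normal_density 0 (sqrt (t - s)))"
      using st by (intro centered_gaussian_distributed[OF prob_space_axioms] ghs_gaussian[OF G]) auto
  next
    fix n :: nat and \<tau> :: "nat \<Rightarrow> real"
    assume \<tau>: "\<forall>i\<le>n. \<tau> i \<in> {0..T}" "\<forall>i<n. \<tau> i \<le> \<tau> (Suc i)"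
    have mono: "\<tau> i \<le> \<tau> (i + m)" if "i + m \<le> n" for i m
      using that
    proof (induction m)
      case (Suc m)
      then have "\<tau> i \<le> \<tau> (i + m)" by simp
      also have "\<dots> \<le> \<tau> (i + Suc m)" using \<tau>(2) Suc.prems by simp
      finally show ?case .
    qed simp
    \<comment> \<open>\<open>mono\<close> yields \<tau>(i+1) \<le> \<tau>(j), so increment i ends no
      later than increment j begins. Repeated times only produce zero increments.\<close>
    have lt: "(LINT \<omega>|M. (W (\<tau> (Suc i)) \<omega> - W (\<tau> i) \<omega>) * (W (\<tau> (Suc j)) \<omega> - W (\<tau> j) \<omega>)) = 0"
      if "i < j" "j < n" for i j
      using that \<tau> mono[of "Suc i" "j - Suc i"] by (intro orth) auto
    show "indep_vars (\<lambda>_. borel) (\<lambda>i \<omega>. W (\<tau> (Suc i)) \<omega> - W (\<tau> i) \<omega>) {..<n}"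
    proof (rule ghs_orthogonal_indep_vars[OF G])
      show "(\<lambda>\<omega>. W (\<tau> (Suc i)) \<omega> - W (\<tau> i) \<omega>) \<in> G" if "i \<in> {..<n}" for i
        using that \<tau>(1) by (intro ghs_diff[OF G] W) auto
      fix i j assume "i \<in> {..<n}" "j \<in> {..<n}" "i \<noteq> j"
      then show "(LINT \<omega>|M. (W (\<tau> (Suc i)) \<omega> - W (\<tau> i) \<omega>) * (W (\<tau> (Suc j)) \<omega> - W (\<tau> j) \<omega>)) = 0"
        using lt[of i j] lt[of j i] by (cases i j rule: linorder_cases) (simp_all add: mult.commute)
    qed simp
  qed
qed

section \<open>The Gaussian free field\<close>

text \<open>The two defining properties of conditional expectation are checked for
  \<open>h p\<close>: measurability, and equal integrals over each event because the residual
  integrates to 0 there. The second conclusion is the same orthogonality as a covariance identity,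
  from which the covariance of \<open>W\<close> is computed.\<close>

lemma gff_cond_exp_eq_projection:
  assumes "open D" and h: "gaussian_free_field M D h"
    and f: "f \<in> H D" "p \<in> H_perp D U"
    and orth: "\<And>v. v \<in> H_perp D U \<Longrightarrow> dirichlet_inner D (\<lambda>x. f x - p x) v = 0"
  shows "AE \<omega> in M. real_cond_exp M (F_perp M D h U) (h f) \<omega> = h p \<omega>"
    and "v \<in> H_perp D U \<Longrightarrow> (LINT \<omega>|M. h f \<omega> * h v \<omega>) = (LINT \<omega>|M. h p \<omega> * h v \<omega>)"
proof -
  define G where "G = {X \<in> borel_measurable M. \<exists>f\<in>H D. AE \<omega> in M. X \<omega> = h f \<omega>}"
  have G: "gaussian_hilbert_space M G"
    and hm: "\<And>f. f \<in> H D \<Longrightarrow> h f \<in> borel_measurable M"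
    using h by (auto simp: gaussian_free_field_def G_def)
  interpret prob_space M using G by (simp add: gaussian_hilbert_space_def)
  have hG: "h f \<in> G" if "f \<in> H D" for f
    using that hm by (auto simp: G_def)
  have V: "H_perp D U \<subseteq> H D" by (auto simp: H_perp_def)
  then have p: "p \<in> H D" using f by auto
  have g: "(\<lambda>x. f x - p x) \<in> H D" by (intro H_diff assms p)
  have "AE \<omega> in M. h (\<lambda>x. 1 * f x + (-1) * p x) \<omega> = 1 * h f \<omega> + (-1) * h p \<omega>"
    using h f(1) p unfolding gaussian_free_field_def by blast
  then have lin: "AE \<omega> in M. h (\<lambda>x. f x - p x) \<omega> = h f \<omega> - h p \<omega>"
    by simp
  have R: "(\<lambda>\<omega>. h f \<omega> - h p \<omega>) \<in> G" by (intro ghs_diff[OF G] hG f p)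
  have R_orth: "(LINT \<omega>|M. (h f \<omega> - h p \<omega>) * h v \<omega>) = 0" if v: "v \<in> H_perp D U" for v
  proof -
    have vH: "v \<in> H D" using v V by auto
    note [measurable] = hm[OF f(1)] hm[OF p] hm[OF g] hm[OF vH]
    have "(LINT \<omega>|M. (h f \<omega> - h p \<omega>) * h v \<omega>) = (LINT \<omega>|M. h (\<lambda>x. f x - p x) \<omega> * h v \<omega>)"
      using lin by (intro integral_cong_AE) auto
    also have "\<dots> = dirichlet_inner D (\<lambda>x. f x - p x) v"
      using h g vH by (simp add: gaussian_free_field_def)
    finally show ?thesis using orth[OF v] by simp
  qed
  show "(LINT \<omega>|M. h f \<omega> * h v \<omega>) = (LINT \<omega>|M. h p \<omega> * h v \<omega>)" if v: "v \<in> H_perp D U"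
  proof -
    have vH: "v \<in> H D" using v V by auto
    have "(LINT \<omega>|M. (h f \<omega> - h p \<omega>) * h v \<omega>) = (LINT \<omega>|M. h f \<omega> * h v \<omega> - h p \<omega> * h v \<omega>)"
      by (simp add: left_diff_distrib)
    then show ?thesis
      using R_orth[OF v] by (simp add: ghs_integrable_mult[OF G] hG f p vH)
  qed
  let ?E = "{h f -` B \<inter> space M |f B. f \<in> H_perp D U \<and> B \<in> sets borel}"
  have sets_F: "sets (F_perp M D h U) = sigma_sets (space M) ?E"
    unfolding F_perp_def by (rule sets_measure_of) auto
  have space_F: "space (F_perp M D h U) = space M"
    unfolding F_perp_def by (rule space_measure_of) auto
  have "?E \<subseteq> sets M"
    using V by (blast intro: measurable_sets[OF hm])
  then have sub: "subalgebra M (F_perp M D h U)"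
    unfolding subalgebra_def sets_F space_F by (intro conjI refl sets.sigma_sets_subset)
  interpret sigma_finite_subalgebra M "F_perp M D h U"
    by (intro finite_measure_subalgebra_is_sigma_finite finite_measure_subalgebra.intro
        finite_measure_axioms finite_measure_subalgebra_axioms.intro sub)
  show "AE \<omega> in M. real_cond_exp M (F_perp M D h U) (h f) \<omega> = h p \<omega>"
  proof (rule real_cond_exp_charact)
    show int: "integrable M (h f)" "integrable M (h p)"
      by (intro ghs_integrable[OF G] hG f p)+
    \<comment> \<open>As \<open>p\<close> lies in \<open>H_perp D U\<close>, \<open>h p\<close> is
      one of the generating variables and is measurable exactly, not merely up to a null
      set.\<close>
    show "h p \<in> borel_measurable (F_perp M D h U)"
      using f(2) by (intro measurableI) (auto simp: space_F sets_F intro!: sigma_sets.Basic)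
    fix A assume A: "A \<in> sets (F_perp M D h U)"
    then have [measurable]: "A \<in> sets M" using sub by (auto simp: subalgebra_def)
    have EV: "?E \<subseteq> {Y -` B \<inter> space M |Y B. Y \<in> h ` H_perp D U \<and> B \<in> sets borel}"
      by blast
    have "A \<in> sigma_sets (space M) {Y -` B \<inter> space M |Y B. Y \<in> h ` H_perp D U \<and> B \<in> sets borel}"
      using A unfolding sets_F by (rule subsetD[OF sigma_sets_mono'[OF EV]])
    moreover have "h ` H_perp D U \<subseteq> G" using hG V by auto
    ultimately have "(LINT \<omega>:A|M. h f \<omega> - h p \<omega>) = 0"
      using R_orth by (intro ghs_orthogonal_integral_eq_0[OF G R]) auto
    moreover have "(LINT \<omega>:A|M. h f \<omega> - h p \<omega>) = (LINT \<omega>:A|M. h f \<omega>) - (LINT \<omega>:A|M. h p \<omega>)"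
      by (intro set_integral_diff; unfold set_integrable_def; intro integrable_mult_indicator int; measurable)
    ultimately show "(LINT \<omega>:A|M. h f \<omega>) = (LINT \<omega>:A|M. h p \<omega>)"
      by simp
  qed
qed

theorem mainTheorem2:
  fixes D :: "(real ^ 2) set"
    and M :: "'w measure"
    and h :: "(real ^ 2 \<Rightarrow> real) \<Rightarrow> 'w \<Rightarrow> real"
    and f0 :: "real ^ 2 \<Rightarrow> real"
    and T :: real
    and \<gamma> :: "real \<Rightarrow> real ^ 2"
    and P :: "real \<Rightarrow> (real ^ 2 \<Rightarrow> real) \<Rightarrow> real ^ 2 \<Rightarrow> real"
    and W :: "real \<Rightarrow> 'w \<Rightarrow> real"
  assumes "open D" and "D \<noteq> {}" and "simply_connected D" and "bounded D"
    and "gaussian_free_field M D h"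
    and "f0 \<in> H D"
    and "\<exists>c<0. has_laplacian_on D f0 (\<lambda>_. c)"
    and "T = (dirichlet_norm D f0)\<^sup>2"
    and "continuous_on {0..T} \<gamma>" and "\<gamma> ` {0..T} = closure D"
    and "\<And>t. t \<in> {0..T} \<Longrightarrow> is_orth_proj D (H_perp D (D - \<gamma> ` {0..t})) (P t)"
    and "\<And>t. t \<in> {0..T} \<Longrightarrow> (dirichlet_norm D (P t f0))\<^sup>2 = t"
    and "\<And>t. t \<in> {0..T} \<Longrightarrow> W t = real_cond_exp M (F_perp M D h (D - \<gamma> ` {0..t})) (h f0)"
  shows "(\<forall>t\<in>{0..T}. AE \<omega> in M. W t \<omega> = h (P t f0) \<omega>) \<and>
         brownian_fdd M T W \<and>
         (\<forall>(N :: 'b measure) B. standard_brownian_motion N T B \<longrightarrow>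
            process_law M T W = process_law N T B)"
proof -
  let ?V = "\<lambda>t. H_perp D (D - \<gamma> ` {0..t})"
  define G where "G = {X \<in> borel_measurable M. \<exists>f\<in>H D. AE \<omega> in M. X \<omega> = h f \<omega>}"
  have G: "gaussian_hilbert_space M G"
    and hm: "\<And>f. f \<in> H D \<Longrightarrow> h f \<in> borel_measurable M"
    and inner: "\<And>f g. f \<in> H D \<Longrightarrow> g \<in> H D \<Longrightarrow> (LINT \<omega>|M. h f \<omega> * h g \<omega>) = dirichlet_inner D f g"
    using assms(5) by (auto simp: gaussian_free_field_def G_def)
  have "0 \<le> T" using assms(8) by simp
  have PV: "P t f0 \<in> ?V t" and PH: "P t f0 \<in> H D"
    and P_orth: "\<And>v. v \<in> ?V t \<Longrightarrow> dirichlet_inner D (\<lambda>x. f0 x - P t f0 x) v = 0"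
    if "t \<in> {0..T}" for t
    using assms(11)[OF that] assms(6) by (auto simp: is_orth_proj_def H_perp_def)
  have cond_exp: "AE \<omega> in M. real_cond_exp M (F_perp M D h (D - \<gamma> ` {0..t})) (h f0) \<omega> = h (P t f0) \<omega>"
    and proj: "\<And>v. v \<in> ?V t \<Longrightarrow> (LINT \<omega>|M. h f0 \<omega> * h v \<omega>) = (LINT \<omega>|M. h (P t f0) \<omega> * h v \<omega>)"
    if "t \<in> {0..T}" for t
    using gff_cond_exp_eq_projection[OF assms(1,5,6) PV[OF that] P_orth[OF that]] by blast+
  have W: "AE \<omega> in M. W t \<omega> = h (P t f0) \<omega>" if "t \<in> {0..T}" for t
    unfolding assms(13)[OF that] by (rule cond_exp[OF that])
  \<comment> \<open>\<open>W t\<close> is one version of a conditional expectation; \<open>G\<close>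
    contains all versions, so almost sure equality suffices.\<close>
  have WG: "W t \<in> G" if "t \<in> {0..T}" for t
    using W[OF that] PH[OF that] by (auto simp: G_def assms(13)[OF that])
  have norm: "(LINT \<omega>|M. h (P t f0) \<omega> * h (P t f0) \<omega>) = t" if t: "t \<in> {0..T}" for t
  proof -
    \<comment> \<open>Nonnegativity, read off the expectation, is what lets the square cancel the
      root in \<open>dirichlet_norm\<close>.\<close>
    have "0 \<le> (LINT \<omega>|M. h (P t f0) \<omega> * h (P t f0) \<omega>)"
      by (intro Bochner_Integration.integral_nonneg) simp
    then show ?thesis
      using assms(12)[OF t] by (simp add: inner PH[OF t] dirichlet_norm_def)
  qed
  have cov: "(LINT \<omega>|M. W s \<omega> * W t \<omega>) = s" if st: "0 \<le> s" "s \<le> t" "t \<le> T" for s t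
  proof -
    have s: "s \<in> {0..T}" and t: "t \<in> {0..T}" using st by auto
    have "?V s \<subseteq> ?V t"
      using st by (intro H_perp_antimono) auto
    then have "P s f0 \<in> ?V t" using PV[OF s] by auto
    note [measurable] = hm[OF PH[OF s]] hm[OF PH[OF t]] ghs_measurable[OF G WG[OF s]] ghs_measurable[OF G WG[OF t]]
    \<comment> \<open>Since \<open>P s f0\<close> lies in the larger space at time t, the projection
      at t can be replaced by \<open>f0\<close>; the projection property at s then turns
      \<open>f0\<close> into \<open>P s f0\<close>.\<close>
    have "(LINT \<omega>|M. W s \<omega> * W t \<omega>) = (LINT \<omega>|M. h (P t f0) \<omega> * h (P s f0) \<omega>)"
      using W[OF s] W[OF t] by (intro integral_cong_AE) auto
    also have "\<dots> = (LINT \<omega>|M. h f0 \<omega> * h (P s f0) \<omega>)"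
      by (rule proj[OF t \<open>P s f0 \<in> ?V t\<close>, symmetric])
    also have "\<dots> = s"
      using proj[OF s PV[OF s]] norm[OF s] by simp
    finally show ?thesis .
  qed
  have fdd: "brownian_fdd M T W"
    by (rule ghs_brownian_fdd[OF G WG cov \<open>0 \<le> T\<close>])
  moreover have "process_law M T W = process_law N T B" if "standard_brownian_motion N T B"
    for N :: "'b measure" and B
    using that fdd \<open>0 \<le> T\<close> by (intro brownian_fdd_process_law_unique) (auto simp: standard_brownian_motion_def)
  ultimately show ?thesis
    using W by blast
qed

end
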